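(* Let $\Delta H=(1,2,\ldots,\alpha,h_\alpha,\ldots,h_\sigma)$ be a valid Hilbert function with $\Delta H^\star=(h_1^\star,\ldots,h_\alpha^\star)$, and let $$d=\sum_{i=1}^{\alpha-1}\min\left\{\left\lfloor\frac{(h_i^\star-(i-1))_+}{2}\right\rfloor,\ \#\{k \mid i+1\le k\le\alpha \text{ and } h_k^\star\ge i\}\right\}.$$ (i) The integer $d$ satisfies $\min\left\{\left\lfloor\frac{\sigma+1}{2}\right\rfloor,\alpha-1\right\}\le d\le\binom{\alpha}{2}$. (ii) For every integer $1\le e\le d$, there exists a scheme $Z$ in $\mathbb{P}^2$ of $e$ double points and $\left(\sum\Delta H\right)-3e$ reduced points with $H_Z=H$. (iii) Let $e=\min\left\{\left\lfloor\frac{\sigma+1}{2}\right\rfloor,\alpha-1\right\}$. Then there exists a scheme $Z$ in $\mathbb{P}^2$ with $e$ double points and $\left(\sum\Delta H\right)-3e$ reduced points with $H_Z=H$.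
   Context: Let $k$ be an algebraically closed field of characteristic zero, $\mathbb{P}^2=\mathbb{P}^2_k$ and $R=k[x_0,x_1,x_2]$ with the standard grading. For distinct points $P_1,\ldots,P_s\in\mathbb{P}^2$ with homogeneous ideals $I_{P_i}$ and positive integers $m_i$, the set of fat points $Z=m_1P_1+\cdots+m_sP_s$ is the scheme defined by $I_Z=I_{P_1}^{m_1}\cap\cdots\cap I_{P_s}^{m_s}$; a point with $m_i=2$ is a double point of $Z$, and one with $m_i=1$ is a reduced point of $Z$. The Hilbert function of $Z$ is $H_Z(i)=\dim_k(R/I_Z)_i$. A valid Hilbert function is a finite sequence of positive integers $\Delta H=(h_0,\ldots,h_\sigma)$, $\sigma\ge1$, for which there is an integer $\alpha$ with $1\le\alpha\le\sigma+1$ such that $h_i=i+1$ for $0\le i<\alpha$ and $\alpha\ge h_\alpha\ge h_{\alpha+1}\ge\cdots\ge h_\sigma$. The corresponding function $H:\mathbb{N}\to\mathbb{N}$ is $H(i)=\sum_{j=0}^i h_j$ (with $h_j=0$ for $j>\sigma$). The conjugate of $\Delta H$ is $\Delta H^\star=(h_1^\star,\ldots,h_\alpha^\star)$ with $h_i^\star=\#\{j\mid h_j\ge i\}$. Also $\sum\Delta H=\sum_{i=0}^\sigma h_i$, and $n_+=\max\{n,0\}$ for an integer $n$. *)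

theory Defs
  imports "HOL-Analysis.Analysis" "HOL-Library.Poly_Mapping"
    "HOL-Computational_Algebra.Polynomial"
begin

section \<open>The graded ring $k[x_0,x_1,x_2]$\<close>

text \<open>
  Monomials are exponent vectors indexed by the three-element type \<^typ>\<open>3\<close>. A polynomial is a
  finitely supported coefficient function on monomials, and multiplication is convolution.
\<close>

type_synonym mon3 = "3 \<Rightarrow>\<^sub>0 nat"
type_synonym 'k mpoly3 = "mon3 \<Rightarrow>\<^sub>0 'k"

definition mon_degree :: "mon3 \<Rightarrow> nat" where
  "mon_degree m = (\<Sum>j\<in>UNIV. Poly_Mapping.lookup m j)"

definition const3 :: "'k::zero \<Rightarrow> 'k mpoly3" where
  "const3 c = Poly_Mapping.single 0 c"

definition eval3 :: "'k::comm_ring_1 mpoly3 \<Rightarrow> 'k ^ 3 \<Rightarrow> 'k" where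
  "eval3 f v = (\<Sum>m\<in>Poly_Mapping.keys f.
      Poly_Mapping.lookup f m * (\<Prod>j\<in>UNIV. (v $ j) ^ Poly_Mapping.lookup m j))"

definition forms :: "nat \<Rightarrow> 'k::zero mpoly3 set" where
  "forms i = {f. \<forall>m\<in>Poly_Mapping.keys f. mon_degree m = i}"

text \<open>Submodules of a commutative ring over itself are its ideals; \<open>ideal.span\<close> generates them.\<close>

interpretation ideal: module "(*) :: 'a::comm_ring_1 \<Rightarrow> 'a \<Rightarrow> 'a"
  by unfold_locales (simp_all add: algebra_simps)

fun ideal_power :: "'a::comm_ring_1 set \<Rightarrow> nat \<Rightarrow> 'a set" where
  "ideal_power I 0 = UNIV"
| "ideal_power I (Suc n) = ideal.span {a * b | a b. a \<in> I \<and> b \<in> ideal_power I n}"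


section \<open>Hilbert functions\<close>

text \<open>
  \<open>residue_basis I i B\<close>: the residue classes modulo \<open>I\<close> of the elements of \<open>B\<close> are pairwise
  distinct and form a basis of the \<open>k\<close>-vector space $(R/I)_i$, the image of $R_i$ in $R/I$.
\<close>

definition residue_basis :: "'k::field mpoly3 set \<Rightarrow> nat \<Rightarrow> 'k mpoly3 set \<Rightarrow> bool" where
  "residue_basis I i B \<longleftrightarrow>
     finite B \<and> B \<subseteq> forms i \<and>
     (\<forall>c. (\<Sum>b\<in>B. const3 (c b) * b) \<in> I \<longrightarrow> (\<forall>b\<in>B. c b = 0)) \<and>
     (\<forall>f\<in>forms i. \<exists>c. f - (\<Sum>b\<in>B. const3 (c b) * b) \<in> I)"

definition hilbert_function :: "'k::field mpoly3 set \<Rightarrow> nat \<Rightarrow> nat" where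
  "hilbert_function I i = (THE n. \<exists>B. residue_basis I i B \<and> card B = n)"

text \<open>
  For an ideal \<open>I\<close> the description above determines a unique number.
\<close>

interpretation mpoly3_vs: vector_space "\<lambda>c (f :: 'k::field mpoly3). const3 c * f"
  by unfold_locales
    (simp_all add: const3_def distrib_left distrib_right single_add mult_single flip: mult.assoc)

lemma subspace_forms: "mpoly3_vs.subspace (forms i :: 'k::field mpoly3 set)"
proof (rule mpoly3_vs.subspaceI)
  show "(0 :: 'k mpoly3) \<in> forms i" by (simp add: forms_def)
next
  fix f g :: "'k mpoly3" assume "f \<in> forms i" "g \<in> forms i"
  then show "f + g \<in> forms i"
    using Poly_Mapping.keys_add[of f g] by (auto simp: forms_def)
next
  fix c and f :: "'k mpoly3" assume "f \<in> forms i"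
  moreover have "Poly_Mapping.keys (const3 c * f) \<subseteq> Poly_Mapping.keys f"
  proof
    fix m assume "m \<in> Poly_Mapping.keys (const3 c * f)"
    then obtain a b where "m = a + b" "a \<in> Poly_Mapping.keys (const3 c)" "b \<in> Poly_Mapping.keys f"
      using keys_mult[of "const3 c" f] by blast
    then show "m \<in> Poly_Mapping.keys f" by (auto simp: const3_def split: if_splits)
  qed
  ultimately show "const3 c * f \<in> forms i" by (auto simp: forms_def)
qed

lemma subspace_ideal: "ideal.subspace (I :: 'k::field mpoly3 set) \<Longrightarrow> mpoly3_vs.subspace I"
  by (auto simp: ideal.subspace_def mpoly3_vs.subspace_def)

lemma finite_monomials: "finite {m. mon_degree m = i}"
proof -
  have "Poly_Mapping.lookup ` {m. mon_degree m = i} \<subseteq> PiE UNIV (\<lambda>_. {..i})"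
  proof
    fix g assume "g \<in> Poly_Mapping.lookup ` {m. mon_degree m = i}"
    then obtain m where m: "g = Poly_Mapping.lookup m" "mon_degree m = i" by blast
    have "Poly_Mapping.lookup m x \<le> (\<Sum>j\<in>UNIV. Poly_Mapping.lookup m j)" for x
      by (rule member_le_sum) auto
    then show "g \<in> PiE UNIV (\<lambda>_. {..i})" using m by (auto simp: mon_degree_def)
  qed
  then have "finite (Poly_Mapping.lookup ` {m. mon_degree m = i})"
    by (rule finite_subset) (auto intro: finite_PiE)
  then show ?thesis
    by (rule finite_imageD) (auto simp: inj_on_def lookup_inject)
qed

lemma forms_in_span:
  "(forms i :: 'k::field mpoly3 set) \<subseteq>
     mpoly3_vs.span ((\<lambda>m. Poly_Mapping.single m 1) ` {m. mon_degree m = i})"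
proof
  fix f :: "'k mpoly3" assume f: "f \<in> forms i"
  have "f = (\<Sum>m\<in>Poly_Mapping.keys f. Poly_Mapping.single m (Poly_Mapping.lookup f m))"
    by (rule poly_mapping_eqI)
      (auto simp: lookup_sum lookup_single when_def in_keys_iff)
  also have "\<dots> = (\<Sum>m\<in>Poly_Mapping.keys f. const3 (Poly_Mapping.lookup f m) * Poly_Mapping.single m 1)"
    by (simp add: const3_def mult_single)
  also have "\<dots> \<in> mpoly3_vs.span ((\<lambda>m. Poly_Mapping.single m 1) ` {m. mon_degree m = i})"
    using f by (intro mpoly3_vs.span_sum mpoly3_vs.span_scale mpoly3_vs.span_base)
      (auto simp: forms_def)
  finally show "f \<in> mpoly3_vs.span ((\<lambda>m. Poly_Mapping.single m 1) ` {m. mon_degree m = i})" .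
qed

lemma independent_forms_finite:
  assumes "mpoly3_vs.independent (B :: 'k::field mpoly3 set)" "B \<subseteq> forms i"
  shows "finite B"
proof -
  have "B \<subseteq> mpoly3_vs.span ((\<lambda>m. Poly_Mapping.single m 1) ` {m. mon_degree m = i})"
    using assms(2) forms_in_span by blast
  then show ?thesis
    using mpoly3_vs.independent_span_bound[OF finite_imageI[OF finite_monomials] assms(1)] by blast
qed

lemma residue_basis_union:
  assumes I: "ideal.subspace (I :: 'k::field mpoly3 set)"
    and C: "C \<subseteq> I \<inter> forms i" "mpoly3_vs.independent C" "I \<inter> forms i \<subseteq> mpoly3_vs.span C"
    and B: "residue_basis I i B"
  shows "B \<inter> C = {}" "mpoly3_vs.independent (B \<union> C)" "forms i \<subseteq> mpoly3_vs.span (B \<union> C)"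
proof -
  have finB: "finite B" and Bf: "B \<subseteq> forms i"
    and ind: "\<And>c. (\<Sum>b\<in>B. const3 (c b) * b) \<in> I \<Longrightarrow> (\<forall>b\<in>B. c b = 0)"
    and sp: "\<And>f. f \<in> forms i \<Longrightarrow> \<exists>c. f - (\<Sum>b\<in>B. const3 (c b) * b) \<in> I"
    using B by (auto simp: residue_basis_def)
  have finC: "finite C" using C independent_forms_finite by blast
  note sI = subspace_ideal[OF I]
  show disj: "B \<inter> C = {}"
  proof (rule ccontr)
    assume "B \<inter> C \<noteq> {}"
    then obtain x where x: "x \<in> B" "x \<in> C" by blast
    have "(\<Sum>b\<in>B. const3 (if b = x then 1 else 0) * b) = (\<Sum>b\<in>B. if b = x then b else 0)"
      by (rule sum.cong) (auto simp: const3_def)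
    also have "\<dots> = x" using x finB by (simp add: sum.delta)
    finally have "(\<Sum>b\<in>B. const3 (if b = x then 1 else 0) * b) \<in> I" using x C by auto
    from bspec[OF ind[OF this] x(1)] show False by simp
  qed
  show "mpoly3_vs.independent (B \<union> C)"
  proof (rule mpoly3_vs.independent_if_scalars_zero)
    show "finite (B \<union> C)" using finB finC by simp
    fix c x assume s: "(\<Sum>b\<in>B \<union> C. const3 (c b) * b) = 0" and x: "x \<in> B \<union> C"
    have s': "(\<Sum>b\<in>B. const3 (c b) * b) + (\<Sum>b\<in>C. const3 (c b) * b) = 0"
      using s sum.union_disjoint[OF finB finC disj, of "\<lambda>b. const3 (c b) * b"] by simp
    have "(\<Sum>b\<in>C. const3 (c b) * b) \<in> I"
      using C by (intro mpoly3_vs.subspace_sum[OF sI] mpoly3_vs.subspace_scale[OF sI]) auto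
    from mpoly3_vs.subspace_neg[OF sI this] have "(\<Sum>b\<in>B. const3 (c b) * b) \<in> I"
      using s' by (simp add: add_eq_0_iff2)
    then have cB: "\<forall>b\<in>B. c b = 0" by (rule ind)
    then have "(\<Sum>b\<in>C. const3 (c b) * b) = 0" using s' by (simp add: const3_def)
    then have "\<forall>b\<in>C. c b = 0"
      using mpoly3_vs.independentD[OF C(2) finC order_refl] by auto
    then show "c x = 0" using cB x by auto
  qed
  show "forms i \<subseteq> mpoly3_vs.span (B \<union> C)"
  proof
    fix f :: "'k mpoly3" assume f: "f \<in> forms i"
    obtain c where c: "f - (\<Sum>b\<in>B. const3 (c b) * b) \<in> I" using sp[OF f] by blast
    have "(\<Sum>b\<in>B. const3 (c b) * b) \<in> forms i"
      using Bf by (intro mpoly3_vs.subspace_sum mpoly3_vs.subspace_scale subspace_forms) auto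
    then have "f - (\<Sum>b\<in>B. const3 (c b) * b) \<in> mpoly3_vs.span C"
      using C(3) c f mpoly3_vs.subspace_diff[OF subspace_forms] by blast
    then have 1: "f - (\<Sum>b\<in>B. const3 (c b) * b) \<in> mpoly3_vs.span (B \<union> C)"
      using mpoly3_vs.span_mono[of C "B \<union> C"] by blast
    have "(\<Sum>b\<in>B. const3 (c b) * b) \<in> mpoly3_vs.span (B \<union> C)"
      by (intro mpoly3_vs.span_sum mpoly3_vs.span_scale mpoly3_vs.span_base) auto
    from mpoly3_vs.span_add[OF 1 this] show "f \<in> mpoly3_vs.span (B \<union> C)" by simp
  qed
qed

lemma residue_basis_card:
  assumes I: "ideal.subspace (I :: 'k::field mpoly3 set)" and B: "residue_basis I i B"
  shows "card B + mpoly3_vs.dim (I \<inter> forms i) = mpoly3_vs.dim (forms i :: 'k mpoly3 set)"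
proof -
  obtain C where C: "C \<subseteq> I \<inter> forms i" "mpoly3_vs.independent C"
      "I \<inter> forms i \<subseteq> mpoly3_vs.span C" "card C = mpoly3_vs.dim (I \<inter> forms i)"
    using mpoly3_vs.basis_exists by metis
  note u = residue_basis_union[OF I C(1-3) B]
  have "finite C" using C independent_forms_finite by blast
  moreover have "finite B" "B \<subseteq> forms i" using B by (auto simp: residue_basis_def)
  moreover have "card (B \<union> C) = mpoly3_vs.dim (forms i :: 'k mpoly3 set)"
    using u C \<open>B \<subseteq> forms i\<close> by (intro mpoly3_vs.basis_card_eq_dim) auto
  ultimately show ?thesis using u(1) C(4) by (simp add: card_Un_disjoint)
qed

lemma residue_basis_exists:
  assumes I: "ideal.subspace (I :: 'k::field mpoly3 set)"
  shows "\<exists>B. residue_basis I i B"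
proof -
  obtain C where C: "C \<subseteq> I \<inter> forms i" "mpoly3_vs.independent C"
      "I \<inter> forms i \<subseteq> mpoly3_vs.span C"
    using mpoly3_vs.basis_exists by metis
  obtain D where D: "C \<subseteq> D" "D \<subseteq> forms i" "mpoly3_vs.independent D"
      "forms i \<subseteq> mpoly3_vs.span D"
    using mpoly3_vs.maximal_independent_subset_extend[of C "forms i"] C by blast
  have finD: "finite D" using D independent_forms_finite by blast
  have finC: "finite C" using finD D(1) finite_subset by blast
  note sI = subspace_ideal[OF I]
  have "residue_basis I i (D - C)"
    unfolding residue_basis_def
  proof (intro conjI allI impI ballI)
    show "finite (D - C)" using finD by simp
    show "D - C \<subseteq> forms i" using D by blast
  next
    fix c b assume s: "(\<Sum>b\<in>D - C. const3 (c b) * b) \<in> I" and b: "b \<in> D - C"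
    have "(\<Sum>b\<in>D - C. const3 (c b) * b) \<in> forms i"
      using D by (intro mpoly3_vs.subspace_sum mpoly3_vs.subspace_scale subspace_forms) auto
    with s C(3) have "(\<Sum>b\<in>D - C. const3 (c b) * b) \<in> mpoly3_vs.span C" by blast
    then obtain e where e: "(\<Sum>b\<in>D - C. const3 (c b) * b) = (\<Sum>b\<in>C. const3 (e b) * b)"
      using mpoly3_vs.span_finite[OF finC] by auto
    define g where "g b = (if b \<in> C then - e b else c b)" for b
    have "(\<Sum>b\<in>D. const3 (g b) * b) =
        (\<Sum>b\<in>D - C. const3 (g b) * b) + (\<Sum>b\<in>C. const3 (g b) * b)"
      by (rule sum.subset_diff[OF D(1) finD])
    also have "(\<Sum>b\<in>D - C. const3 (g b) * b) = (\<Sum>b\<in>D - C. const3 (c b) * b)"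
      by (rule sum.cong) (auto simp: g_def)
    also have "(\<Sum>b\<in>C. const3 (g b) * b) = - (\<Sum>b\<in>C. const3 (e b) * b)"
      unfolding sum_negf[symmetric]
      by (rule sum.cong) (auto simp: g_def mpoly3_vs.scale_minus_left)
    finally have "(\<Sum>b\<in>D. const3 (g b) * b) = 0" using e by simp
    then have "g b = 0" using mpoly3_vs.independentD[OF D(3) finD order_refl] b by auto
    then show "c b = 0" using b by (simp add: g_def)
  next
    fix f :: "'k mpoly3" assume "f \<in> forms i"
    then obtain c where "f = (\<Sum>b\<in>D. const3 (c b) * b)"
      using D(4) mpoly3_vs.span_finite[OF finD] by auto
    then have "f - (\<Sum>b\<in>D - C. const3 (c b) * b) = (\<Sum>b\<in>C. const3 (c b) * b)"
      using sum.subset_diff[OF D(1) finD, of "\<lambda>b. const3 (c b) * b"] by simp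
    also have "\<dots> \<in> I"
      using C by (intro mpoly3_vs.subspace_sum[OF sI] mpoly3_vs.subspace_scale[OF sI]) auto
    finally show "\<exists>c. f - (\<Sum>b\<in>D - C. const3 (c b) * b) \<in> I" by blast
  qed
  then show ?thesis by blast
qed

lemma hilbert_function_eq_card:
  assumes "ideal.subspace (I :: 'k::field mpoly3 set)" "residue_basis I i B"
  shows "hilbert_function I i = card B"
  unfolding hilbert_function_def
proof (rule the_equality)
  show "\<exists>B'. residue_basis I i B' \<and> card B' = card B" using assms(2) by blast
  fix n assume "\<exists>B'. residue_basis I i B' \<and> card B' = n"
  then show "n = card B" using residue_basis_card[OF assms(1)] assms(2) by (metis add_right_cancel)
qed

lemma hilbert_function_add_dim:
  assumes "ideal.subspace (I :: 'k::field mpoly3 set)"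
  shows "hilbert_function I i + mpoly3_vs.dim (I \<inter> forms i)
       = mpoly3_vs.dim (forms i :: 'k mpoly3 set)"
  using assms residue_basis_exists residue_basis_card hilbert_function_eq_card by metis


section \<open>Fat points in the projective plane\<close>

text \<open>Points of $\mathbb{P}^2_k$ are the one-dimensional subspaces of $k^3$.\<close>

definition proj_plane :: "('k::field ^ 3) set set" where
  "proj_plane = {L. vec.subspace L \<and> vec.dim L = 1}"

definition point_ideal :: "('k::field ^ 3) set \<Rightarrow> 'k mpoly3 set" where
  "point_ideal P = ideal.span {f. (\<exists>i. f \<in> forms i) \<and> (\<forall>v\<in>P. eval3 f v = 0)}"

text \<open>
  A set of fat points $m_1P_1+\cdots+m_sP_s$ is the multiset of points in which each $P_i$ occurs
  with multiplicity $m_i$.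
\<close>

definition fat_points :: "('k::field ^ 3) set multiset \<Rightarrow> bool" where
  "fat_points Z \<longleftrightarrow> set_mset Z \<subseteq> proj_plane"

definition fat_ideal :: "('k::field ^ 3) set multiset \<Rightarrow> 'k mpoly3 set" where
  "fat_ideal Z = (\<Inter>P\<in>set_mset Z. ideal_power (point_ideal P) (count Z P))"

lemma subspace_fat_ideal: "ideal.subspace (fat_ideal Z)"
proof -
  have "ideal.subspace (ideal_power I n)" for I :: "'a mpoly3 set" and n
    by (cases n) (simp_all add: ideal.subspace_UNIV)
  then show ?thesis
    unfolding fat_ideal_def by (intro ideal.subspace_Inter) auto
qed

text \<open>The number of reduced points is an integer argument, so that it can be given as a difference.\<close>

definition double_and_reduced_points :: "('k::field ^ 3) set multiset \<Rightarrow> nat \<Rightarrow> int \<Rightarrow> bool" where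
  "double_and_reduced_points Z e r \<longleftrightarrow>
     fat_points Z \<and>
     (\<forall>P\<in>set_mset Z. count Z P = 1 \<or> count Z P = 2) \<and>
     card {P \<in> set_mset Z. count Z P = 2} = e \<and>
     int (card {P \<in> set_mset Z. count Z P = 1}) = r"


section \<open>Valid Hilbert functions\<close>

text \<open>
  \<open>valid_hilbert_function h \<sigma> \<alpha>\<close>: the list \<open>h\<close> is $(h_0,\ldots,h_\sigma)$. The chain
  $\alpha \ge h_\alpha \ge \cdots \ge h_\sigma$ is void if $\alpha = \sigma + 1$.
\<close>

definition valid_hilbert_function :: "nat list \<Rightarrow> nat \<Rightarrow> nat \<Rightarrow> bool" where
  "valid_hilbert_function h \<sigma> \<alpha> \<longleftrightarrow>
     length h = \<sigma> + 1 \<and> 1 \<le> \<sigma> \<and> (\<forall>i\<le>\<sigma>. 0 < h ! i) \<and>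
     1 \<le> \<alpha> \<and> \<alpha> \<le> \<sigma> + 1 \<and>
     (\<forall>i<\<alpha>. h ! i = i + 1) \<and>
     (\<alpha> \<le> \<sigma> \<longrightarrow> h ! \<alpha> \<le> \<alpha>) \<and>
     (\<forall>i. \<alpha> \<le> i \<and> i < \<sigma> \<longrightarrow> h ! Suc i \<le> h ! i)"

definition cumulative :: "nat list \<Rightarrow> nat \<Rightarrow> nat" where
  "cumulative h i = (\<Sum>j\<le>i. if j < length h then h ! j else 0)"

definition conjugate :: "nat list \<Rightarrow> nat \<Rightarrow> nat" where
  "conjugate h i = card {j. j < length h \<and> i \<le> h ! j}"

text \<open>Subtraction of natural numbers truncates at 0, which is the positive part $(\cdot)_+$ here.\<close>

definition d_bound :: "nat list \<Rightarrow> nat \<Rightarrow> nat" where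
  "d_bound h \<alpha> =
     (\<Sum>i = 1..\<alpha> - 1. min ((conjugate h i - (i - 1)) div 2)
                         (card {k. i + 1 \<le> k \<and> k \<le> \<alpha> \<and> i \<le> conjugate h k}))"

end

theory Submission
  imports Defs
begin

text \<open>
  The schemes are unions of points on \<open>\<alpha>\<close> lines. If a double point is put on the intersection of
  two lines \<open>\<ell>\<^sub>i\<close> and \<open>\<ell>\<^sub>k\<close> with \<open>i < k\<close>, then it meets \<open>\<ell>\<^sub>i\<close> in degree 2, and once \<open>\<ell>\<^sub>i\<close> is
  removed (by taking the residual scheme) it is a reduced point, which meets \<open>\<ell>\<^sub>k\<close> in degree 1. So if
  the lines are removed in order, the degree \<open>d\<^sub>k\<close> found on \<open>\<ell>\<^sub>k\<close> is the number of reduced points on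
  it, plus the number of double points shared with earlier lines, plus twice the number of double
  points shared with later lines.

  When \<open>d\<^sub>1 > d\<^sub>2 > \<dots> > d\<^sub>\<alpha> > 0\<close>, these degrees determine the Hilbert function: it is
  \<open>t \<mapsto> \<Sum>\<^sub>k min d\<^sub>k (t + 2 - k)\<close> with subtraction truncated at 0. A form in
  the ideal of the scheme has at least \<open>d\<^sub>1\<close> zeros on \<open>\<ell>\<^sub>1\<close>, with multiplicities, so it vanishes on
  \<open>\<ell>\<^sub>1\<close> as soon as its restriction has degree below \<open>d\<^sub>1\<close>. Hence the powers of a coordinate of \<open>\<ell>\<^sub>1\<close>
  with exponents below \<open>min d\<^sub>1 (t + 1)\<close>, together with the products of the equation of \<open>\<ell>\<^sub>1\<close> with a
  residue basis of degree \<open>t - 1\<close> for the residual scheme, are independent modulo the ideal. They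
  span in degree \<open>t\<close>: if \<open>t + 1 \<le> d\<^sub>1\<close>, because every polynomial of degree at most \<open>t\<close> on \<open>\<ell>\<^sub>1\<close> is a
  combination of these powers; if \<open>t + 1 > d\<^sub>1\<close>, because strict decrease makes none of the minima
  truncate, so that there are \<open>\<Sum>\<^sub>k d\<^sub>k\<close> of them, and the ideal is cut out by as many linear
  conditions. This is \<open>residue_basis_prescribed_zeros\<close>.

  The conjugate of a valid Hilbert function is strictly decreasing, and its cumulative function is
  exactly the one above with \<open>d\<^sub>k = h\<^sub>k\<^sup>\<star>\<close> (\<open>cumulative_eq_truncated_sum\<close>). So it remains to choose
  pairs of lines whose double points contribute at most \<open>h\<^sub>k\<^sup>\<star>\<close> to each line and to fill up with
  reduced points. Line \<open>i\<close> is joined to at most \<open>(h\<^sub>i\<^sup>\<star> - (i - 1)) / 2\<close> later lines, and only to lines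
  \<open>k\<close> with \<open>h\<^sub>k\<^sup>\<star> \<ge> i\<close>; the maximal number of pairs of this kind is \<open>d\<close>, and the bounds survive
  passing to a subset of the pairs (\<open>exists_pairs_of_lines\<close>).

  General position is made explicit by tangent lines of a conic. The line \<open>\<ell>\<^sub>a\<close> consists of the points
  \<open>(a + s : a s : 1)\<close> and one point at infinity. Two of the points with parameters \<open>(a, s)\<close> and
  \<open>(a', s')\<close> coincide iff \<open>{a, s} = {a', s'}\<close> as multisets, so \<open>\<ell>\<^sub>a\<close> and \<open>\<ell>\<^sub>b\<close> meet in the point
  with parameters \<open>(a, b)\<close>, and no three of the lines are concurrent.
\<close>

(* As rewrite rules these two undo associativity of multiplication, which is used below. *)
declare ideal.scale_scale [simp del] mpoly3_vs.scale_scale [simp del]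

section \<open>Forms and their restriction to tangent lines of a conic\<close>

definition var3 :: "3 \<Rightarrow> 'k::comm_ring_1 mpoly3" where
  "var3 j = Poly_Mapping.single (Poly_Mapping.single j 1) 1"

lemma const3_0 [simp]: "const3 0 = 0" and const3_1 [simp]: "const3 1 = 1"
  by (simp_all add: const3_def)

definition monomial_on_line :: "'k::field \<Rightarrow> mon3 \<Rightarrow> 'k poly" where
  "monomial_on_line a m = [:a, 1:] ^ Poly_Mapping.lookup m 1 * [:0, a:] ^ Poly_Mapping.lookup m 2"

text \<open>
  The homomorphism \<open>f \<mapsto> f(a + X, a X, 1)\<close> to polynomials in \<open>X\<close>: restriction to the line \<open>\<ell>\<^sub>a\<close> in
  terms of its parameter.
\<close>

definition restrict_line :: "'k::field \<Rightarrow> 'k mpoly3 \<Rightarrow> 'k poly" where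
  "restrict_line a f =
     (\<Sum>m\<in>Poly_Mapping.keys f. smult (Poly_Mapping.lookup f m) (monomial_on_line a m))"

lemma restrict_line_superset:
  assumes "finite A" "Poly_Mapping.keys f \<subseteq> A"
  shows "restrict_line a f = (\<Sum>m\<in>A. smult (Poly_Mapping.lookup f m) (monomial_on_line a m))"
  unfolding restrict_line_def
  by (rule sum.mono_neutral_left) (use assms in \<open>auto simp: in_keys_iff\<close>)

lemma restrict_line_single:
  "restrict_line a (Poly_Mapping.single m c) = smult c (monomial_on_line a m)"
  by (subst restrict_line_superset[of "{m}"]) auto

lemma restrict_line_0 [simp]: "restrict_line a 0 = 0"
  by (simp add: restrict_line_def)

lemma restrict_line_add [simp]:
  "restrict_line a (f + g) = restrict_line a f + restrict_line a g"
  using restrict_line_superset[of "Poly_Mapping.keys f \<union> Poly_Mapping.keys g" "f + g" a]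
    restrict_line_superset[of "Poly_Mapping.keys f \<union> Poly_Mapping.keys g" f a]
    restrict_line_superset[of "Poly_Mapping.keys f \<union> Poly_Mapping.keys g" g a]
    Poly_Mapping.keys_add[of f g]
  by (simp add: lookup_add smult_add_left sum.distrib)

lemma restrict_line_sum: "restrict_line a (sum f A) = (\<Sum>x\<in>A. restrict_line a (f x))"
  by (induction A rule: infinite_finite_induct) auto

lemma poly_mapping_sum_single:
  "(\<Sum>m\<in>Poly_Mapping.keys f. Poly_Mapping.single m (Poly_Mapping.lookup f m)) = f"
  by (rule poly_mapping_eqI) (auto simp: lookup_sum lookup_single when_def in_keys_iff)

lemma monomial_on_line_add:
  "monomial_on_line a (m + n) = monomial_on_line a m * monomial_on_line a n"
  by (simp add: monomial_on_line_def lookup_add power_add)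

lemma restrict_line_mult [simp]:
  "restrict_line a (f * g) = restrict_line a f * restrict_line a g"
proof -
  have "f * g = (\<Sum>m\<in>Poly_Mapping.keys f. \<Sum>n\<in>Poly_Mapping.keys g.
      Poly_Mapping.single (m + n) (Poly_Mapping.lookup f m * Poly_Mapping.lookup g n))"
    by (subst poly_mapping_sum_single[symmetric, of f],
        subst poly_mapping_sum_single[symmetric, of g])
      (simp add: sum_product mult_single)
  then have "restrict_line a (f * g) = (\<Sum>m\<in>Poly_Mapping.keys f. \<Sum>n\<in>Poly_Mapping.keys g.
      smult (Poly_Mapping.lookup f m * Poly_Mapping.lookup g n) (monomial_on_line a (m + n)))"
    by (simp add: restrict_line_sum restrict_line_single)
  also have "\<dots> = restrict_line a f * restrict_line a g"
    unfolding restrict_line_def sum_product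
    by (intro sum.cong) (simp_all add: monomial_on_line_add mult.commute)
  finally show ?thesis .
qed

lemma restrict_line_const [simp]: "restrict_line a (const3 c) = [:c:]"
  by (simp add: const3_def restrict_line_single monomial_on_line_def)

lemma restrict_line_1 [simp]: "restrict_line a 1 = 1"
  using restrict_line_const[of a 1] by (simp add: const3_def)

lemma restrict_line_minus [simp]: "restrict_line a (- f) = - restrict_line a f"
  using restrict_line_add[of a f "- f"] by (simp add: eq_neg_iff_add_eq_0 add.commute)

lemma restrict_line_diff [simp]:
  "restrict_line a (f - g) = restrict_line a f - restrict_line a g"
  using restrict_line_add[of a f "- g"] by simp

lemma restrict_line_power [simp]: "restrict_line a (f ^ n) = restrict_line a f ^ n"
  by (induction n) auto

lemma restrict_line_var3 [simp]:
  "restrict_line a (var3 1) = [:a, 1:]" "restrict_line a (var3 2) = [:0, a:]"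
  "restrict_line a (var3 3) = 1"
  by (simp_all add: var3_def restrict_line_single monomial_on_line_def lookup_single when_def)

definition plane_point :: "'k::field \<Rightarrow> 'k \<Rightarrow> 'k ^ 3" where
  "plane_point a s = vector [a + s, a * s, 1]"

lemma plane_point_commute: "plane_point a s = plane_point s a"
  by (simp add: plane_point_def add.commute mult.commute)

lemma poly_restrict_line: "poly (restrict_line a f) s = eval3 f (plane_point a s)"
proof -
  have prod3: "(\<Prod>j\<in>UNIV. g j) = g 1 * g 2 * g 3" for g :: "3 \<Rightarrow> 'a"
    unfolding UNIV_3 by simp
  show ?thesis
    unfolding restrict_line_def eval3_def prod3 poly_sum
    by (intro sum.cong refl)
      (simp add: monomial_on_line_def plane_point_def poly_power add.commute mult.commute)
qed

lemma poly_restrict_line_commute: "poly (restrict_line a f) b = poly (restrict_line b f) a"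
  by (simp add: poly_restrict_line plane_point_commute)

lemma mon_degree_3:
  "mon_degree m = Poly_Mapping.lookup m 1 + Poly_Mapping.lookup m 2 + Poly_Mapping.lookup m 3"
  by (simp add: mon_degree_def sum_3)

lemma mon_degree_add: "mon_degree (m + n) = mon_degree m + mon_degree n"
  by (simp add: mon_degree_3 lookup_add)

lemma forms_mult:
  assumes "f \<in> forms i" "g \<in> forms j" shows "f * g \<in> forms (i + j)"
  using keys_mult[of f g] assms by (fastforce simp: forms_def mon_degree_add)

lemma forms_const: "const3 c \<in> forms 0"
  by (auto simp: const3_def forms_def mon_degree_3)

lemma forms_1: "1 \<in> forms 0"
  using forms_const[of 1] by (simp add: const3_def flip: single_one)

lemma forms_scale: "f \<in> forms i \<Longrightarrow> const3 c * f \<in> forms i" for f :: "'k::field mpoly3"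
  using subspace_forms by (rule mpoly3_vs.subspace_scale)

lemma forms_power: "f \<in> forms i \<Longrightarrow> f ^ n \<in> forms (n * i)"
  by (induction n) (auto intro: forms_mult simp: forms_1)

lemma forms_var3: "var3 j \<in> forms 1"
  using exhaust_3[of j] by (auto simp: var3_def forms_def mon_degree_3 lookup_single when_def)

lemma degree_restrict_line_le:
  assumes "f \<in> forms i" shows "degree (restrict_line a f) \<le> i"
  unfolding restrict_line_def
proof (rule degree_sum_le)
  fix m assume m: "m \<in> Poly_Mapping.keys f"
  have "degree (monomial_on_line a m) \<le> degree ([:a, 1:] ^ Poly_Mapping.lookup m 1) +
      degree ([:0, a:] ^ Poly_Mapping.lookup m 2)"
    unfolding monomial_on_line_def by (rule degree_mult_le)
  also have "\<dots> \<le> Poly_Mapping.lookup m 1 + Poly_Mapping.lookup m 2"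
    by (intro add_mono order.trans[OF degree_power_le]) simp_all
  also have "\<dots> \<le> i" using m assms by (auto simp: forms_def mon_degree_3)
  finally show "degree (smult (Poly_Mapping.lookup f m) (monomial_on_line a m)) \<le> i"
    using degree_smult_le le_trans by blast
qed simp

text \<open>
  Induction on the degree of forms: every monomial is reached from 1 by multiplication with variables.
\<close>

lemma forms_subset_by_variables:
  fixes W :: "nat \<Rightarrow> 'k::field mpoly3 set"
  assumes sub: "\<And>i. mpoly3_vs.subspace (W i)" and one: "1 \<in> W 0"
    and var: "\<And>i j f. f \<in> W i \<Longrightarrow> var3 j * f \<in> W (Suc i)"
  shows "forms i \<subseteq> W i"
proof -
  have "Poly_Mapping.single m 1 \<in> W i" if "mon_degree m = i" for m
    using that
  proof (induction i arbitrary: m)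
    case 0
    then have "m = 0"
      by (intro poly_mapping_eqI) (metis add_is_0 exhaust_3 lookup_zero mon_degree_3)
    then show ?case using one by simp
  next
    case (Suc i)
    then obtain j where j: "Poly_Mapping.lookup m j > 0"
      by (metis add_is_0 gr0I mon_degree_3 nat.distinct(1))
    define n where "n = m - Poly_Mapping.single j 1"
    have m: "m = Poly_Mapping.single j 1 + n"
      using j by (intro poly_mapping_eqI)
        (auto simp: n_def lookup_add lookup_minus lookup_single when_def)
    have "mon_degree (Poly_Mapping.single j (1::nat)) = 1"
      using exhaust_3[of j] by (auto simp: mon_degree_3 lookup_single when_def)
    then have "mon_degree n = i" using Suc.prems m by (simp add: mon_degree_add)
    from var[OF Suc.IH[OF this], of j] show ?case
      by (simp add: var3_def mult_single m)
  qed
  then have "mpoly3_vs.span ((\<lambda>m. Poly_Mapping.single m 1) ` {m. mon_degree m = i}) \<subseteq> W i"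
    by (intro mpoly3_vs.span_minimal sub) auto
  with forms_in_span show ?thesis by blast
qed

section \<open>Division of a form by the equation of a line\<close>

text \<open>
  The equation \<open>x\<^sub>1 - a x\<^sub>0 + a\<^sup>2 x\<^sub>2\<close> of \<open>\<ell>\<^sub>a\<close>; on \<open>\<ell>\<^sub>b\<close> it becomes \<open>(b - a) (X - a)\<close>. Since the index
  type \<^typ>\<open>3\<close> has the elements 1, 2 and 3, these stand for the subscripts 0, 1 and 2 here.
\<close>

definition line_form :: "'k::field \<Rightarrow> 'k mpoly3" where
  "line_form a = var3 2 - const3 a * var3 1 + const3 (a * a) * var3 3"

text \<open>
  A linear form whose restriction to \<open>\<ell>\<^sub>a\<close> is the parameter \<open>X\<close>, so that \<open>line_monomial a t j\<close> is a
  form of degree \<open>t\<close> that restricts to \<open>X\<^sup>j\<close>.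
\<close>

definition line_coord :: "'k::field \<Rightarrow> 'k mpoly3" where
  "line_coord a = var3 1 - const3 a * var3 3"

definition line_monomial :: "'k::field \<Rightarrow> nat \<Rightarrow> nat \<Rightarrow> 'k mpoly3" where
  "line_monomial a t j = line_coord a ^ j * var3 3 ^ (t - j)"

text \<open>
  Forms of degree \<open>t - 1\<close>, where degree \<open>-1\<close> leaves only 0. This makes division of a constant by a
  linear form a case like the others.
\<close>

definition forms_below :: "nat \<Rightarrow> 'k::field mpoly3 set" where
  "forms_below t = (case t of 0 \<Rightarrow> {0} | Suc n \<Rightarrow> forms n)"

lemma const3_mult: "const3 (a * b) = const3 a * (const3 b :: 'k::field mpoly3)"
  by (simp add: const3_def mult_single)

lemma restrict_line_line_form: "restrict_line b (line_form c) = smult (b - c) [:- c, 1:]"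
  by (simp add: line_form_def algebra_simps)

lemma restrict_line_line_monomial: "restrict_line a (line_monomial a t j) = monom 1 j"
  by (simp add: line_monomial_def line_coord_def monom_altdef)

lemma line_coord_forms: "line_coord a \<in> forms 1" for a :: "'k::field"
  unfolding line_coord_def
  by (intro mpoly3_vs.subspace_diff[OF subspace_forms] forms_scale forms_var3)

lemma line_form_forms: "line_form a \<in> forms 1" for a :: "'k::field"
  unfolding line_form_def
  by (intro mpoly3_vs.subspace_add[OF subspace_forms] mpoly3_vs.subspace_diff[OF subspace_forms]
      forms_scale forms_var3)

lemma line_monomial_forms: "j \<le> t \<Longrightarrow> line_monomial a t j \<in> forms t" for a :: "'k::field"
  using forms_mult[OF forms_power[OF line_coord_forms[of a], of j]
      forms_power[OF forms_var3[of 3], of "t - j"]]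
  by (simp add: line_monomial_def)

lemma subspace_forms_below: "mpoly3_vs.subspace (forms_below t)"
  by (cases t) (auto simp: forms_below_def subspace_forms mpoly3_vs.subspace_0)

lemma mult_forms_below:
  assumes "u \<in> forms 1" "g \<in> forms_below t" shows "u * g \<in> forms t"
  using assms forms_mult[of u 1 g]
  by (cases t) (auto simp: forms_below_def mpoly3_vs.subspace_0[OF subspace_forms])

lemma mult_forms_below_Suc:
  assumes "u \<in> forms 1" "g \<in> forms_below t" shows "u * g \<in> forms_below (Suc t)"
  using mult_forms_below[OF assms] by (simp add: forms_below_def)

definition homogenize :: "'k::field \<Rightarrow> nat \<Rightarrow> 'k poly \<Rightarrow> 'k mpoly3" where
  "homogenize a t p = (\<Sum>j\<le>t. const3 (coeff p j) * line_monomial a t j)"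

lemma homogenize_0 [simp]: "homogenize a t 0 = 0"
  by (simp add: homogenize_def)

lemma homogenize_add: "homogenize a t (p + q) = homogenize a t p + homogenize a t q"
  by (simp add: homogenize_def sum.distrib mpoly3_vs.scale_left_distrib)

lemma homogenize_smult: "homogenize a t (smult k p) = const3 k * homogenize a t p"
  by (simp add: homogenize_def sum_distrib_left const3_mult mult.assoc)

lemma homogenize_forms: "homogenize a t p \<in> forms t"
  unfolding homogenize_def
  by (intro mpoly3_vs.subspace_sum[OF subspace_forms] forms_scale line_monomial_forms) simp

lemma homogenize_pCons: "homogenize a (Suc t) (pCons 0 p) = line_coord a * homogenize a t p"
  by (simp add: homogenize_def sum.atMost_Suc_shift sum_distrib_left line_monomial_def
      mult.left_commute mult.assoc del: sum.atMost_Suc)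

lemma homogenize_Suc:
  assumes "degree p \<le> t" shows "homogenize a (Suc t) p = var3 3 * homogenize a t p"
proof -
  have "coeff p (Suc t) = 0" using assms by (simp add: coeff_eq_0)
  then show ?thesis
    by (auto simp: homogenize_def sum_distrib_left line_monomial_def Suc_diff_le
        mult.left_commute mult.assoc intro!: sum.cong)
qed

lemma restrict_line_homogenize:
  "degree p \<le> t \<Longrightarrow> restrict_line a (homogenize a t p) = p"
  by (simp add: homogenize_def restrict_line_sum restrict_line_line_monomial smult_monom
      poly_as_sum_of_monoms')

text \<open>
  Modulo the equation of \<open>\<ell>\<^sub>a\<close>, the ring is a polynomial ring in \<open>line_coord a\<close> and the third
  variable, so a form is recovered from its restriction up to a multiple of the equation. In
  particular a form that vanishes on \<open>\<ell>\<^sub>a\<close> is divisible by the equation of \<open>\<ell>\<^sub>a\<close>.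
\<close>

lemma line_decomposition:
  fixes a :: "'k::field"
  assumes "f \<in> forms t"
  obtains g where "g \<in> forms_below t"
    "f = homogenize a t (restrict_line a f) + line_form a * g"
proof -
  define W where "W t = {homogenize a t p + line_form a * g | p g.
    degree p \<le> t \<and> g \<in> forms_below t}" for t
  have W_forms: "W t \<subseteq> forms t" for t
    by (auto simp: W_def intro!: mpoly3_vs.subspace_add[OF subspace_forms] homogenize_forms
        mult_forms_below line_form_forms)
  have WI: "x \<in> W t" if "x = homogenize a t p + line_form a * g" "degree p \<le> t" "g \<in> forms_below t"
    for x p g t unfolding W_def using that by blast
  have sub: "mpoly3_vs.subspace (W t)" for t
  proof (rule mpoly3_vs.subspaceI)
    show "0 \<in> W t"
      by (rule WI[of _ _ 0 0]) (auto simp: mpoly3_vs.subspace_0[OF subspace_forms_below])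
  next
    fix x y assume "x \<in> W t" "y \<in> W t"
    then obtain p g p' g' where
      "x = homogenize a t p + line_form a * g" "degree p \<le> t" "g \<in> forms_below t"
      "y = homogenize a t p' + line_form a * g'" "degree p' \<le> t" "g' \<in> forms_below t"
      by (auto simp: W_def)
    then show "x + y \<in> W t"
      by (intro WI[of _ _ "p + p'" "g + g'"])
        (auto simp: homogenize_add distrib_left degree_add_le
          mpoly3_vs.subspace_add[OF subspace_forms_below])
  next
    fix k x assume "x \<in> W t"
    then obtain p g where
      "x = homogenize a t p + line_form a * g" "degree p \<le> t" "g \<in> forms_below t"
      by (auto simp: W_def)
    then show "const3 k * x \<in> W t"
      by (intro WI[of _ _ "smult k p" "const3 k * g"])
        (auto simp: homogenize_smult distrib_left mult.left_commute
          mpoly3_vs.subspace_scale[OF subspace_forms_below] intro: degree_smult_le[THEN le_trans])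
  qed
  have coord: "line_coord a * f \<in> W (Suc t)" if f: "f \<in> W t" for f t
  proof -
    obtain p g where f: "f = homogenize a t p + line_form a * g" "degree p \<le> t" "g \<in> forms_below t"
      using f by (auto simp: W_def)
    then show ?thesis
      by (intro WI[of _ _ "pCons 0 p" "line_coord a * g"])
        (auto simp: homogenize_pCons distrib_left mult.left_commute
          intro!: mult_forms_below_Suc line_coord_forms order.trans[OF degree_pCons_le])
  qed
  have third: "var3 3 * f \<in> W (Suc t)" if f: "f \<in> W t" for f t
  proof -
    obtain p g where f: "f = homogenize a t p + line_form a * g" "degree p \<le> t" "g \<in> forms_below t"
      using f by (auto simp: W_def)
    then show ?thesis
      by (intro WI[of _ _ p "var3 3 * g"])
        (auto simp: homogenize_Suc distrib_left mult.left_commute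
          intro!: mult_forms_below_Suc forms_var3)
  qed
  have line: "line_form a * f \<in> W (Suc t)" if f: "f \<in> W t" for f t
    using W_forms f by (intro WI[of _ _ 0 f]) (auto simp: forms_below_def)
  have "forms t \<subseteq> W t"
  proof (rule forms_subset_by_variables[OF sub])
    show "1 \<in> W 0"
      by (rule WI[of _ _ 1 0])
        (auto simp: homogenize_def line_monomial_def mpoly3_vs.subspace_0[OF subspace_forms_below])
  next
    fix i f and j :: 3 assume f: "f \<in> W i"
    have 1: "var3 1 = line_coord a + const3 a * var3 3"
      by (simp add: line_coord_def)
    have 2: "var3 2 = line_form a + const3 a * line_coord a"
      by (simp add: line_form_def line_coord_def const3_mult algebra_simps)
    note closed = mpoly3_vs.subspace_add[OF sub] mpoly3_vs.subspace_scale[OF sub]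
    consider "j = 1" | "j = 2" | "j = 3" using exhaust_3 by blast
    then show "var3 j * f \<in> W (Suc i)"
    proof cases
      case 1
      then show ?thesis using f
        by (simp add: \<open>var3 1 = _\<close> distrib_right mult.assoc closed coord third)
    next
      case 2
      then show ?thesis using f
        by (simp add: \<open>var3 2 = _\<close> distrib_right mult.assoc closed coord line)
    qed (use third f in simp)
  qed
  with assms have "f \<in> W t" ..
  then obtain p g where
    f: "f = homogenize a t p + line_form a * g" "degree p \<le> t" and g: "g \<in> forms_below t"
    by (auto simp: W_def)
  have "restrict_line a f = p"
    using f(2) by (simp add: f(1) restrict_line_homogenize restrict_line_line_form)
  then show thesis using that[OF g] f(1) by metis
qed

section \<open>Roots of polynomials in one variable\<close>

definition double_root :: "'k::field poly \<Rightarrow> 'k \<Rightarrow> bool" where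
  "double_root p s \<longleftrightarrow> poly p s = 0 \<and> poly (pderiv p) s = 0"

lemma double_root_iff_dvd: "double_root p s \<longleftrightarrow> [:- s, 1:] ^ 2 dvd p"
proof
  assume p: "double_root p s"
  then obtain q where q: "p = [:- s, 1:] * q"
    by (auto simp: double_root_def poly_eq_0_iff_dvd)
  have "poly q s = 0"
    using p by (simp add: double_root_def q pderiv_mult pderiv_pCons del: mult_pCons_left)
  then obtain r where "q = [:- s, 1:] * r" by (auto simp: poly_eq_0_iff_dvd)
  then have "p = [:- s, 1:] ^ 2 * r" using q by (simp only: power2_eq_square mult.assoc)
  then show "[:- s, 1:] ^ 2 dvd p" by (rule dvdI)
next
  assume "[:- s, 1:] ^ 2 dvd p"
  then obtain q where "p = [:- s, 1:] * ([:- s, 1:] * q)"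
    unfolding power2_eq_square dvd_def mult.assoc by blast
  then show "double_root p s"
    by (simp add: double_root_def pderiv_mult del: mult_pCons_left)
qed

lemma eq_0_if_many_roots:
  assumes fin: "finite A" "finite B" and disj: "A \<inter> B = {}"
    and A: "\<And>s. s \<in> A \<Longrightarrow> poly p s = 0" and B: "\<And>s. s \<in> B \<Longrightarrow> double_root p s"
    and deg: "degree p < card A + 2 * card B"
  shows "p = 0"
proof (rule ccontr)
  assume p: "p \<noteq> 0"
  have "mset_set A + repeat_mset 2 (mset_set B) \<subseteq># proots p"
  proof (rule mset_subset_eqI)
    fix s
    have "1 \<le> order s p" if "s \<in> A" using A[OF that] p by (simp add: order_root Suc_le_eq)
    moreover have "2 \<le> order s p" if "s \<in> B"
      using B[OF that] p by (simp add: double_root_iff_dvd order_divides)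
    ultimately show "count (mset_set A + repeat_mset 2 (mset_set B)) s \<le> count (proots p) s"
      using p fin disj by (auto simp: count_mset_set')
  qed
  from size_mset_mono[OF this] have "card A + 2 * card B \<le> degree p"
    using size_proots_le[of p] by simp
  with deg show False by simp
qed

text \<open>
  Multiplication by \<open>X - a\<close> raises the multiplicity of the root \<open>a\<close> by one and leaves all other
  multiplicities alone. This is what turns a double point into a reduced one in the residual scheme.
\<close>

lemma roots_linear_mult:
  fixes q :: "'k::field poly"
  assumes "c \<noteq> 0" and p: "p = smult c [:- a, 1:] * q"
  shows root_linear_mult: "s \<noteq> a \<Longrightarrow> poly p s = 0 \<longleftrightarrow> poly q s = 0"
    and double_root_linear_mult: "s \<noteq> a \<Longrightarrow> double_root p s \<longleftrightarrow> double_root q s"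
    and double_root_linear_mult_same: "double_root p a \<longleftrightarrow> poly q a = 0"
proof -
  have p': "p = [:- (c * a), c:] * q" using p by simp
  have "poly p s = c * (s - a) * poly q s" for s
    by (simp add: p' algebra_simps)
  moreover have "poly (pderiv p) s = c * (s - a) * poly (pderiv q) s + c * poly q s" for s
    unfolding p' pderiv_mult by (simp add: pderiv_pCons algebra_simps)
  ultimately show "s \<noteq> a \<Longrightarrow> poly p s = 0 \<longleftrightarrow> poly q s = 0"
    "s \<noteq> a \<Longrightarrow> double_root p s \<longleftrightarrow> double_root q s" "double_root p a \<longleftrightarrow> poly q a = 0"
    using assms(1) by (auto simp: double_root_def)
qed

section \<open>Residues modulo the common kernel of finitely many functionals\<close>

definition linear_functional :: "('k::field mpoly3 \<Rightarrow> 'k) \<Rightarrow> bool" where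
  "linear_functional \<phi> \<longleftrightarrow>
     (\<forall>f g. \<phi> (f + g) = \<phi> f + \<phi> g) \<and> (\<forall>c f. \<phi> (const3 c * f) = c * \<phi> f)"

definition common_kernel :: "('k::field mpoly3 \<Rightarrow> 'k) set \<Rightarrow> 'k mpoly3 set" where
  "common_kernel \<Phi> = {f. \<forall>\<phi>\<in>\<Phi>. \<phi> f = 0}"

definition independent_mod :: "'k::field mpoly3 set \<Rightarrow> 'k mpoly3 set \<Rightarrow> bool" where
  "independent_mod I B \<longleftrightarrow>
     (\<forall>c. (\<Sum>b\<in>B. const3 (c b) * b) \<in> I \<longrightarrow> (\<forall>b\<in>B. c b = 0))"

lemma linear_functional_sum:
  assumes "linear_functional \<phi>"
  shows "\<phi> (\<Sum>b\<in>B. const3 (c b) * b) = (\<Sum>b\<in>B. c b * \<phi> b)"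
proof -
  have add: "\<phi> (f + g) = \<phi> f + \<phi> g" and scale: "\<phi> (const3 c * f) = c * \<phi> f" for f g c
    using assms by (auto simp: linear_functional_def)
  have "\<phi> 0 = 0" using scale[of 0 0] by simp
  then show ?thesis by (induction B rule: infinite_finite_induct) (auto simp: add scale)
qed

text \<open>
  The functionals together form a map into a vector space with one basis vector for each of them, and
  elements independent modulo the common kernel have independent images. The target is realised inside
  the polynomial ring itself, on the powers of a variable.
\<close>

lemma card_independent_mod_kernel_le:
  fixes \<Phi> :: "('k::field mpoly3 \<Rightarrow> 'k) set"
  assumes fin: "finite \<Phi>" "finite B" and lin: "\<And>\<phi>. \<phi> \<in> \<Phi> \<Longrightarrow> linear_functional \<phi>"
    and ind: "independent_mod (common_kernel \<Phi>) B"
  shows "card B \<le> card \<Phi>"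
proof -
  obtain idx :: "('k mpoly3 \<Rightarrow> 'k) \<Rightarrow> nat" where idx: "inj_on idx \<Phi>"
    using finite_imp_inj_to_nat_seg[OF fin(1)] by metis
  define e where "e \<phi> = (Poly_Mapping.single (Poly_Mapping.single 1 (idx \<phi>)) 1 :: 'k mpoly3)" for \<phi>
  \<comment> \<open>The combined map, with \<open>e \<phi>\<close> as the basis vector for \<open>\<phi>\<close>.\<close>
  define \<Psi> where "\<Psi> f = (\<Sum>\<phi>\<in>\<Phi>. const3 (\<phi> f) * e \<phi>)" for f
  have single_inj: "Poly_Mapping.single (1::3) m = Poly_Mapping.single 1 n \<longleftrightarrow> m = n"
    for m n :: nat by (metis lookup_single_eq)
  have lookup_\<Psi>: "Poly_Mapping.lookup (\<Psi> f) (Poly_Mapping.single 1 (idx \<phi>)) = \<phi> f"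
    if \<phi>: "\<phi> \<in> \<Phi>" for f \<phi>
  proof -
    have "Poly_Mapping.lookup (\<Psi> f) (Poly_Mapping.single 1 (idx \<phi>))
        = (\<Sum>\<phi>'\<in>\<Phi>. if \<phi>' = \<phi> then \<phi>' f else 0)"
      unfolding \<Psi>_def lookup_sum
      by (intro sum.cong) (use idx \<phi> in \<open>auto simp: e_def const3_def mult_single lookup_single
          when_def single_inj inj_on_def\<close>)
    then show ?thesis using fin \<phi> by simp
  qed
  have kernel: "f \<in> common_kernel \<Phi>" if "\<Psi> f = 0" for f
    using lookup_\<Psi>[of _ f] that by (simp add: common_kernel_def)
  have \<Psi>_sum: "\<Psi> (\<Sum>b\<in>B. const3 (c b) * b) = (\<Sum>b\<in>B. const3 (c b) * \<Psi> b)" for c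
  proof -
    have "\<Psi> (\<Sum>b\<in>B. const3 (c b) * b) = (\<Sum>\<phi>\<in>\<Phi>. \<Sum>b\<in>B. const3 (c b) * (const3 (\<phi> b) * e \<phi>))"
      unfolding \<Psi>_def
      by (intro sum.cong refl)
        (simp add: linear_functional_sum[OF lin] mpoly3_vs.scale_sum_left mpoly3_vs.scale_scale)
    also have "\<dots> = (\<Sum>b\<in>B. const3 (c b) * \<Psi> b)"
      unfolding \<Psi>_def sum_distrib_left by (rule sum.swap)
    finally show ?thesis .
  qed
  have coeffs: "\<forall>b\<in>B. c b = 0" if "(\<Sum>b\<in>B. const3 (c b) * \<Psi> b) = 0" for c
    using ind kernel[of "\<Sum>b\<in>B. const3 (c b) * b"] that
    by (simp add: \<Psi>_sum independent_mod_def)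
  have inj: "inj_on \<Psi> B"
  proof (rule inj_onI, rule ccontr)
    fix b b' assume b: "b \<in> B" "b' \<in> B" "\<Psi> b = \<Psi> b'" "b \<noteq> b'"
    define c :: "'k mpoly3 \<Rightarrow> 'k" where "c = (\<lambda>x. if x = b then 1 else if x = b' then -1 else 0)"
    have "(\<Sum>x\<in>B. const3 (c x) * \<Psi> x) = (\<Sum>x\<in>{b, b'}. const3 (c x) * \<Psi> x)"
      by (rule sum.mono_neutral_right) (use b fin in \<open>auto simp: c_def\<close>)
    also have "\<dots> = 0" using b by (simp add: c_def mpoly3_vs.scale_minus_left)
    finally have "c b = 0" using coeffs b by blast
    then show False by (simp add: c_def)
  qed
  have "mpoly3_vs.independent (\<Psi> ` B)"
  proof (rule mpoly3_vs.independent_if_scalars_zero)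
    fix c y assume "(\<Sum>y\<in>\<Psi> ` B. const3 (c y) * y) = 0" "y \<in> \<Psi> ` B"
    then show "c y = 0" using coeffs[of "c \<circ> \<Psi>"] by (auto simp: sum.reindex[OF inj])
  qed (use fin in simp)
  moreover have "\<Psi> ` B \<subseteq> mpoly3_vs.span (e ` \<Phi>)"
    unfolding \<Psi>_def
    by (intro image_subsetI mpoly3_vs.span_sum mpoly3_vs.span_scale mpoly3_vs.span_base imageI)
  ultimately have "card (\<Psi> ` B) \<le> card (e ` \<Phi>)"
    using mpoly3_vs.independent_span_bound[of "e ` \<Phi>"] fin by blast
  then show ?thesis using card_image[OF inj] card_image_le[OF fin(1), of e] by linarith
qed

text \<open>
  If some \<open>f\<close> were not a combination of \<open>B\<close> modulo the kernel, then \<open>B\<close> with \<open>f\<close> added would be an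
  independent set that is too large.
\<close>

lemma independent_mod_kernel_spans:
  fixes \<Phi> :: "('k::field mpoly3 \<Rightarrow> 'k) set"
  assumes fin: "finite \<Phi>" "finite B" and lin: "\<And>\<phi>. \<phi> \<in> \<Phi> \<Longrightarrow> linear_functional \<phi>"
    and ind: "independent_mod (common_kernel \<Phi>) B" and card: "card \<Phi> \<le> card B"
  shows "\<exists>s\<in>mpoly3_vs.span B. f - s \<in> common_kernel \<Phi>"
proof (rule ccontr)
  assume no: "\<not> ?thesis"
  have scale: "const3 k * x \<in> common_kernel \<Phi>" if "x \<in> common_kernel \<Phi>" for k x
    unfolding common_kernel_def mem_Collect_eq
  proof
    fix \<phi> assume "\<phi> \<in> \<Phi>"
    then show "\<phi> (const3 k * x) = 0"
      using that lin[of \<phi>] by (simp add: common_kernel_def linear_functional_def)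
  qed
  have "0 \<in> common_kernel \<Phi>"
    using linear_functional_sum[OF lin, of _ _ "{}"] by (simp add: common_kernel_def)
  then have f: "f \<notin> B" using no mpoly3_vs.span_base[of f B] by force
  have "independent_mod (common_kernel \<Phi>) (insert f B)"
    unfolding independent_mod_def
  proof (intro allI impI)
    fix c assume s: "(\<Sum>b\<in>insert f B. const3 (c b) * b) \<in> common_kernel \<Phi>"
    define s' where "s' = (\<Sum>b\<in>B. const3 (c b) * b)"
    have s: "const3 (c f) * f + s' \<in> common_kernel \<Phi>" using s fin f by (simp add: s'_def)
    have span: "s' \<in> mpoly3_vs.span B"
      unfolding s'_def by (intro mpoly3_vs.span_sum mpoly3_vs.span_scale mpoly3_vs.span_base)
    have "c f = 0"
    proof (rule ccontr)
      assume c: "c f \<noteq> 0"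
      have "const3 (inverse (c f)) * (const3 (c f) * f + s') =
          f - const3 (- inverse (c f)) * s'"
        using c by (simp add: distrib_left mpoly3_vs.scale_scale mpoly3_vs.scale_minus_left)
      then have "f - const3 (- inverse (c f)) * s' \<in> common_kernel \<Phi>"
        using scale[OF s, of "inverse (c f)"] by simp
      with no mpoly3_vs.span_scale[OF span] show False by blast
    qed
    moreover from this have "\<forall>b\<in>B. c b = 0" using s ind by (simp add: s'_def independent_mod_def)
    ultimately show "\<forall>b\<in>insert f B. c b = 0" by simp
  qed
  from card_independent_mod_kernel_le[OF fin(1) _ lin this] fin f card show False by simp
qed

section \<open>Forms with prescribed zeros on a star configuration\<close>

text \<open>
  For lines indexed by \<open>X\<close>, the set \<open>T a\<close> holds the parameters of the points that remain on \<open>\<ell>\<^sub>a\<close> when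
  its turn of removal comes: those of its reduced points and those of its intersections with earlier
  lines that carry double points. So \<open>b \<in> T a\<close> for two lines of \<open>X\<close> means a double point on their
  intersection. For an earlier line that has been removed already, \<open>b\<close> is no longer in \<open>X\<close> and the same
  point counts as a reduced one, so \<open>T\<close> stays fixed while \<open>X\<close> shrinks.
\<close>

definition prescribed_zeros :: "('k::field \<Rightarrow> 'k set) \<Rightarrow> 'k set \<Rightarrow> 'k mpoly3 set" where
  "prescribed_zeros T X = {f. \<forall>a\<in>X.
     (\<forall>s\<in>T a - X. poly (restrict_line a f) s = 0) \<and>
     (\<forall>s\<in>X. s \<in> T a \<or> a \<in> T s \<longrightarrow> double_root (restrict_line a f) s)}"

text \<open>
  The degree in which \<open>\<ell>\<^sub>a\<close> meets the scheme after the removal of the earlier lines: the points of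
  \<open>T a\<close> count once, the double points shared with later lines count twice.
\<close>

definition line_degree :: "('k \<Rightarrow> 'k set) \<Rightarrow> 'k set \<Rightarrow> 'k \<Rightarrow> nat" where
  "line_degree T X a = card (T a) + 2 * card {b \<in> X. a \<in> T b}"

text \<open>
  The order of removal is that of the list, and \<open>T a\<close> may contain a line of the list only if that line
  comes before \<open>a\<close>.
\<close>

fun admissible :: "('k \<Rightarrow> 'k set) \<Rightarrow> 'k list \<Rightarrow> bool" where
  "admissible T [] \<longleftrightarrow> True"
| "admissible T (a # L) \<longleftrightarrow>
     finite (T a) \<and> a \<notin> set L \<and> T a \<inter> insert a (set L) = {} \<and> admissible T L"

lemma admissible_finite: "admissible T L \<Longrightarrow> a \<in> set L \<Longrightarrow> finite (T a)"
  by (induction L) auto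

lemma admissible_asym:
  "admissible T L \<Longrightarrow> a \<in> set L \<Longrightarrow> b \<in> set L \<Longrightarrow> a \<in> T b \<Longrightarrow> b \<notin> T a"
  by (induction L) auto

lemma admissible_distinct: "admissible T L \<Longrightarrow> distinct L"
  by (induction L) auto

text \<open>
  For \<open>n = t + 1\<close> this is the value at \<open>t\<close> of the Hilbert function with line degrees \<open>ds\<close>.
\<close>

fun truncated_sum :: "nat list \<Rightarrow> nat \<Rightarrow> nat" where
  "truncated_sum [] n = 0"
| "truncated_sum (d # ds) n = min d n + truncated_sum ds (n - 1)"

lemma truncated_sum_0 [simp]: "truncated_sum ds 0 = 0"
  by (induction ds) auto

lemma truncated_sum_nth: "truncated_sum ds n = (\<Sum>i<length ds. min (ds ! i) (n - i))"
  by (induction ds arbitrary: n) (simp_all add: sum.lessThan_Suc_shift del: sum.lessThan_Suc)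

text \<open>
  Strict decrease makes the entries fall at least as fast as the bound \<open>n\<close> does in the recursion, so
  no minimum truncates.
\<close>

lemma truncated_sum_eq_sum_list:
  assumes "sorted_wrt (>) ds" "\<forall>d\<in>set ds. d \<le> n"
  shows "truncated_sum ds n = sum_list ds"
  using assms
proof (induction ds arbitrary: n)
  case (Cons d ds)
  then have "\<forall>d'\<in>set ds. d' \<le> n - 1" by fastforce
  with Cons show ?case by simp
qed simp

lemma line_degree_insert:
  assumes "T a \<inter> X = {}" "b \<in> X"
  shows "line_degree T (insert a X) b = line_degree T X b"
proof -
  have "{c \<in> insert a X. b \<in> T c} = {c \<in> X. b \<in> T c}" using assms by auto
  then show ?thesis by (simp add: line_degree_def)
qed

lemma restrict_line_eq_0:
  assumes X: "finite X" "finite (T a)" "T a \<inter> insert a X = {}"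
    and f: "f \<in> prescribed_zeros T (insert a X)"
    and deg: "degree (restrict_line a f) < line_degree T (insert a X) a"
  shows "restrict_line a f = 0"
proof (rule eq_0_if_many_roots)
  show "degree (restrict_line a f) < card (T a) + 2 * card {b \<in> insert a X. a \<in> T b}"
    using deg by (simp add: line_degree_def)
qed (use assms in \<open>auto simp: prescribed_zeros_def\<close>)

text \<open>
  Passage to the residual scheme with respect to \<open>\<ell>\<^sub>a\<close>.
\<close>

lemma line_form_mult_prescribed_zeros:
  assumes a: "a \<notin> X" "T a \<inter> insert a X = {}"
  shows "line_form a * g \<in> prescribed_zeros T (insert a X) \<longleftrightarrow> g \<in> prescribed_zeros T X"
proof -
  define p where "p b = restrict_line b (line_form a * g)" for b
  define q where "q b = restrict_line b g" for b
  have pa: "p a = 0" by (simp add: p_def restrict_line_line_form)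
  have p: "p b = smult (b - a) [:- a, 1:] * q b" for b
    by (simp only: p_def q_def restrict_line_mult restrict_line_line_form)
  have b: "b - a \<noteq> 0" if "b \<in> X" for b using a that by auto
  note r = roots_linear_mult[OF b p]
  have "line_form a * g \<in> prescribed_zeros T (insert a X) \<longleftrightarrow>
      (\<forall>b\<in>insert a X. (\<forall>s\<in>T b - insert a X. poly (p b) s = 0) \<and>
        (\<forall>s\<in>insert a X. s \<in> T b \<or> b \<in> T s \<longrightarrow> double_root (p b) s))"
    unfolding prescribed_zeros_def p_def mem_Collect_eq ..
  also have "\<dots> \<longleftrightarrow>
      (\<forall>b\<in>X. (\<forall>s\<in>T b - insert a X. poly (p b) s = 0) \<and>
        (\<forall>s\<in>insert a X. s \<in> T b \<or> b \<in> T s \<longrightarrow> double_root (p b) s))"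
    unfolding ball_insert pa by (simp add: double_root_def)
  also have "\<dots> \<longleftrightarrow> (\<forall>b\<in>X. (\<forall>s\<in>T b - X. poly (q b) s = 0) \<and>
        (\<forall>s\<in>X. s \<in> T b \<or> b \<in> T s \<longrightarrow> double_root (q b) s))"
  proof (rule ball_cong[OF refl])
    fix b assume "b \<in> X"
    note r = r[OF this]
    have "(\<forall>s\<in>T b - insert a X. poly (p b) s = 0) \<longleftrightarrow> (\<forall>s\<in>T b - insert a X. poly (q b) s = 0)"
      using r(1) by blast
    moreover have "(\<forall>s\<in>insert a X. s \<in> T b \<or> b \<in> T s \<longrightarrow> double_root (p b) s) \<longleftrightarrow>
        (a \<in> T b \<longrightarrow> poly (q b) a = 0) \<and>
        (\<forall>s\<in>X. s \<in> T b \<or> b \<in> T s \<longrightarrow> double_root (q b) s)"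
      using r(2,3) a \<open>b \<in> X\<close> by auto metis+
    ultimately show "((\<forall>s\<in>T b - insert a X. poly (p b) s = 0) \<and>
        (\<forall>s\<in>insert a X. s \<in> T b \<or> b \<in> T s \<longrightarrow> double_root (p b) s)) =
        ((\<forall>s\<in>T b - X. poly (q b) s = 0) \<and>
        (\<forall>s\<in>X. s \<in> T b \<or> b \<in> T s \<longrightarrow> double_root (q b) s))"
      using a by auto
  qed
  also have "\<dots> \<longleftrightarrow> g \<in> prescribed_zeros T X"
    by (simp add: prescribed_zeros_def q_def)
  finally show ?thesis .
qed

text \<open>
  There are four obvious linear conditions for a double point on \<open>\<ell>\<^sub>a\<close> and \<open>\<ell>\<^sub>b\<close>, a value and a
  derivative on each line, but the values on the two lines agree. Dropping the value on the later line
  leaves as many conditions as the line degrees count.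
\<close>

lemma prescribed_zeros_kernel:
  assumes X: "finite X" "\<And>a. a \<in> X \<Longrightarrow> finite (T a)"
  obtains \<Phi> where "finite \<Phi>" "card \<Phi> \<le> (\<Sum>a\<in>X. line_degree T X a)"
    "\<And>\<phi>. \<phi> \<in> \<Phi> \<Longrightarrow> linear_functional \<phi>" "common_kernel \<Phi> = prescribed_zeros T X"
proof -
  define ev where "ev a s f = poly (restrict_line a f) s" for a s :: 'a and f
  define ev' where "ev' a s f = poly (pderiv (restrict_line a f)) s" for a s :: 'a and f
  define \<Phi>\<^sub>T where "\<Phi>\<^sub>T a = (\<lambda>s. if s \<in> X then ev' a s else ev a s) ` T a" for a
  define O\<^sub>a where "O\<^sub>a a = {b \<in> X. a \<in> T b}" for a
  define \<Phi> where "\<Phi> = (\<Union>a\<in>X. \<Phi>\<^sub>T a \<union> (ev a ` O\<^sub>a a \<union> ev' a ` O\<^sub>a a))"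
  have finO: "finite (O\<^sub>a a)" for a using X by (simp add: O\<^sub>a_def)
  show thesis
  proof
    show "finite \<Phi>" using X finO by (auto simp: \<Phi>_def \<Phi>\<^sub>T_def)
    have "card (\<Phi>\<^sub>T a \<union> (ev a ` O\<^sub>a a \<union> ev' a ` O\<^sub>a a)) \<le> line_degree T X a" if "a \<in> X" for a
    proof -
      have "card (\<Phi>\<^sub>T a \<union> (ev a ` O\<^sub>a a \<union> ev' a ` O\<^sub>a a))
          \<le> card (\<Phi>\<^sub>T a) + (card (ev a ` O\<^sub>a a) + card (ev' a ` O\<^sub>a a))"
        by (intro order.trans[OF card_Un_le] add_mono card_Un_le order_refl)
      also have "\<dots> \<le> card (T a) + (card (O\<^sub>a a) + card (O\<^sub>a a))"
        unfolding \<Phi>\<^sub>T_def using X that finO by (intro add_mono card_image_le) auto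
      finally show ?thesis by (simp add: line_degree_def O\<^sub>a_def)
    qed
    then show "card \<Phi> \<le> (\<Sum>a\<in>X. line_degree T X a)"
      unfolding \<Phi>_def using X
      by (intro order.trans[OF card_UN_le] sum_mono) auto
    have "linear_functional (ev a s)" "linear_functional (ev' a s)" for a s
      by (simp_all add: linear_functional_def ev_def ev'_def pderiv_add pderiv_smult)
    then show "linear_functional \<phi>" if "\<phi> \<in> \<Phi>" for \<phi>
      using that by (auto simp: \<Phi>_def \<Phi>\<^sub>T_def)
    have mem: "f \<in> common_kernel \<Phi> \<longleftrightarrow> (\<forall>a\<in>X.
        (\<forall>s\<in>T a. if s \<in> X then ev' a s f = 0 else ev a s f = 0) \<and>
        (\<forall>b\<in>X. a \<in> T b \<longrightarrow> ev a b f = 0 \<and> ev' a b f = 0))" for f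
      unfolding common_kernel_def \<Phi>_def \<Phi>\<^sub>T_def O\<^sub>a_def mem_Collect_eq ball_UN ball_Un ball_simps
      by (intro ball_cong refl) auto
    have swap: "ev a s f = ev s a f" for a s f
      unfolding ev_def by (rule poly_restrict_line_commute)
    have mem': "f \<in> prescribed_zeros T X \<longleftrightarrow> (\<forall>a\<in>X.
        (\<forall>s\<in>T a - X. ev a s f = 0) \<and>
        (\<forall>s\<in>X. s \<in> T a \<or> a \<in> T s \<longrightarrow> ev a s f = 0 \<and> ev' a s f = 0))" for f
      unfolding prescribed_zeros_def double_root_def ev_def ev'_def mem_Collect_eq ..
    have "f \<in> common_kernel \<Phi> \<longleftrightarrow> f \<in> prescribed_zeros T X" for f
    proof
      assume f: "f \<in> common_kernel \<Phi>"
      then have "ev a s f = 0" if "a \<in> X" "s \<in> X" "s \<in> T a" for a s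
        using that unfolding mem swap[of a s] by blast
      with f show "f \<in> prescribed_zeros T X" unfolding mem mem' by auto
    next
      assume "f \<in> prescribed_zeros T X"
      then show "f \<in> common_kernel \<Phi>" unfolding mem mem' by auto
    qed
    then show "common_kernel \<Phi> = prescribed_zeros T X" by blast
  qed
qed

section \<open>A residue basis adapted to the lines\<close>

lemma residue_basisI:
  fixes I :: "'k::field mpoly3 set"
  assumes "finite B" "B \<subseteq> forms t" "independent_mod I B"
    "\<And>f. f \<in> forms t \<Longrightarrow> \<exists>s\<in>mpoly3_vs.span B. f - s \<in> I"
  shows "residue_basis I t B"
  unfolding residue_basis_def
proof (intro conjI ballI)
  fix f :: "'k mpoly3" assume "f \<in> forms t"
  then obtain s where "s \<in> mpoly3_vs.span B" "f - s \<in> I" using assms(4) by blast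
  then show "\<exists>c. f - (\<Sum>b\<in>B. const3 (c b) * b) \<in> I"
    using mpoly3_vs.span_finite[OF assms(1)] by auto
qed (use assms in \<open>auto simp: independent_mod_def\<close>)

lemma residue_basis_independent_mod: "residue_basis I t B \<Longrightarrow> independent_mod I B"
  by (simp add: residue_basis_def independent_mod_def)

lemma residue_basis_spans:
  fixes I :: "'k::field mpoly3 set"
  assumes "residue_basis I t B" "f \<in> forms t"
  shows "\<exists>s\<in>mpoly3_vs.span B. f - s \<in> I"
proof -
  obtain c where "f - (\<Sum>b\<in>B. const3 (c b) * b) \<in> I"
    using assms by (auto simp: residue_basis_def)
  moreover have "(\<Sum>b\<in>B. const3 (c b) * b) \<in> mpoly3_vs.span B"
    by (intro mpoly3_vs.span_sum mpoly3_vs.span_scale mpoly3_vs.span_base)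
  ultimately show ?thesis by blast
qed

lemma line_form_neq_0: "line_form a \<noteq> (0 :: 'k::field mpoly3)"
proof
  assume "line_form a = 0"
  then have "restrict_line (a + 1) (line_form a) = 0" by simp
  then show False by (simp add: restrict_line_line_form)
qed

lemma span_mult:
  assumes "s \<in> mpoly3_vs.span B" "(*) u ` B \<subseteq> mpoly3_vs.span C"
  shows "u * s \<in> mpoly3_vs.span C"
  using assms(1)
proof (rule mpoly3_vs.span_induct)
  show "mpoly3_vs.subspace {s. u * s \<in> mpoly3_vs.span C}"
    by (auto simp: mpoly3_vs.subspace_def distrib_left mult.left_commute[of u]
        intro: mpoly3_vs.span_zero mpoly3_vs.span_add mpoly3_vs.span_scale)
qed (use assms(2) in auto)

text \<open>
  The basis for \<open>a # L\<close> consists of the first powers of the parameter of \<open>\<ell>\<^sub>a\<close> and of the multiples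
  by the equation of \<open>\<ell>\<^sub>a\<close> of a basis for \<open>L\<close> in the degree below.
\<close>

theorem residue_basis_prescribed_zeros:
  fixes T :: "'k::field \<Rightarrow> 'k set"
  assumes "admissible T L"
    and "sorted_wrt (>) (map (line_degree T (set L)) L)"
    and "\<And>a. a \<in> set L \<Longrightarrow> 0 < line_degree T (set L) a"
  shows "\<exists>B. residue_basis (prescribed_zeros T (set L)) t B \<and>
    card B = truncated_sum (map (line_degree T (set L)) L) (Suc t)"
  using assms
proof (induction L arbitrary: t)
  case Nil
  have "residue_basis (prescribed_zeros T {}) t {}"
    by (auto simp: residue_basis_def prescribed_zeros_def)
  then show ?case by (intro exI[of _ "{}"]) simp
next
  case (Cons a L)
  define X where "X = set L"
  define V where "V = prescribed_zeros T (insert a X)"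
  define V' where "V' = prescribed_zeros T X"
  define d where "d = line_degree T (insert a X) a"
  define ds where "ds = map (line_degree T X) L"
  have a: "finite (T a)" "a \<notin> X" "T a \<inter> insert a X = {}" "finite X"
    and adm: "admissible T L"
    using Cons.prems(1) by (auto simp: X_def)
  have degs: "map (line_degree T (insert a X)) L = ds"
    using line_degree_insert[of T a X] a by (auto simp: ds_def X_def)
  have sorted: "sorted_wrt (>) (d # ds)" and d_pos: "d > 0"
    using Cons.prems(2,3) degs by (auto simp: d_def X_def)
  have pos: "0 < line_degree T X b" if "b \<in> X" for b
    using Cons.prems(3)[of b] line_degree_insert[of T a X b] that a by (simp add: X_def)
  have V_iff: "line_form a * g \<in> V \<longleftrightarrow> g \<in> V'" for g
    unfolding V_def V'_def by (rule line_form_mult_prescribed_zeros) (use a in auto)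
  obtain B' where B': "finite B'" "B' \<subseteq> forms_below t" "independent_mod V' B'"
    "\<And>g. g \<in> forms_below t \<Longrightarrow> \<exists>s\<in>mpoly3_vs.span B'. g - s \<in> V'"
    "card B' = truncated_sum ds t"
  text \<open>
      case 0
      have "0 \<in> V'"
  @(* In degree 0 there is no basis of the degree below to take; the empty set serves. *)
\<close>

proof (cases t)
    case 0
    have "0 \<in> V'" by (simp add: V'_def prescribed_zeros_def double_root_def)
    then show ?thesis using that[of "{}"] 0 by (simp add: forms_below_def independent_mod_def)
  next
    case (Suc n)
    from Cons.IH[OF adm, of n] sorted pos obtain B' where
      "residue_basis V' n B'" "card B' = truncated_sum ds (Suc n)"
      by (auto simp: V'_def ds_def X_def)
    then show ?thesis
      using that[of B'] Suc residue_basis_independent_mod[of V' n B'] residue_basis_spans[of V' n B']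
      by (simp add: forms_below_def residue_basis_def[of _ _ B'])
  qed
  define m where "m = min d (Suc t)"
  define M where "M = line_monomial a t ` {..<m}"
  define B where "B = M \<union> (*) (line_form a) ` B'"
  have inj_M: "inj_on (line_monomial a t) A" for A
    by (rule inj_onI)
      (metis monom_eq_iff' one_neq_zero restrict_line_line_monomial)
  have inj_line: "inj_on ((*) (line_form a)) B'"
    using line_form_neq_0[of a] by (auto simp: inj_on_def)
  have restrict_0: "restrict_line a (line_form a * g) = 0" for g
    by (simp add: restrict_line_line_form)
  have "x \<notin> (*) (line_form a) ` B'" if "x \<in> M" for x
  proof
    assume "x \<in> (*) (line_form a) ` B'"
    then have "restrict_line a x = 0" using restrict_0 by blast
    with that show False by (auto simp: M_def restrict_line_line_monomial)
  qed
  then have disj: "M \<inter> (*) (line_form a) ` B' = {}" by blast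
  have finM: "finite M" by (simp add: M_def)
  have finB: "finite B" using finM B' by (simp add: B_def)
  have "card B = m + truncated_sum ds t"
    unfolding B_def using card_Un_disjoint[OF finM _ disj] B'
    by (simp add: M_def card_image inj_M inj_line)
  then have card: "card B = truncated_sum (d # ds) (Suc t)" by (simp add: m_def)
  have "B \<subseteq> forms t"
    using B'(2) mult_forms_below[OF line_form_forms]
    by (auto simp: B_def M_def m_def intro!: line_monomial_forms)
  moreover have ind: "independent_mod V B"
    unfolding independent_mod_def
  proof (intro allI impI)
    fix c assume c: "(\<Sum>b\<in>B. const3 (c b) * b) \<in> V"
    define p where "p = (\<Sum>j<m. monom (c (line_monomial a t j)) j)"
    define G where "G = (\<Sum>b\<in>B'. const3 (c (line_form a * b)) * b)"
    define P where "P = (\<Sum>j<m. const3 (c (line_monomial a t j)) * line_monomial a t j)"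
    have sum: "(\<Sum>b\<in>B. const3 (c b) * b) = P + line_form a * G"
      unfolding B_def
      unfolding sum.union_disjoint[OF finM finite_imageI[OF B'(1)] disj]
      unfolding P_def G_def M_def
      by (simp add: sum.reindex inj_M inj_line sum_distrib_left mult.left_commute)
    have coeff: "coeff p i = (if i < m then c (line_monomial a t i) else 0)" for i
      by (simp add: p_def coeff_sum)
    have restrict: "restrict_line a (P + line_form a * G) = p"
      unfolding restrict_line_add restrict_0
      by (simp add: P_def p_def restrict_line_sum restrict_line_line_monomial smult_monom)
    have "degree p < m" by (rule degree_lessI) (use d_pos in \<open>auto simp: coeff m_def\<close>)
    then have "degree (restrict_line a (P + line_form a * G)) < line_degree T (insert a X) a"
      unfolding restrict d_def[symmetric] by (simp add: m_def)
    from restrict_line_eq_0[OF a(4,1,3) _ this] c have "p = 0"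
      unfolding restrict sum V_def by blast
    then have M0: "c (line_monomial a t i) = 0" if "i < m" for i
      using coeff[of i] that by simp
    then have "P = 0" by (simp add: P_def)
    with c have "G \<in> V'" by (simp add: sum V_iff)
    then have "\<forall>b\<in>B'. c (line_form a * b) = 0"
      unfolding G_def using B'(3) unfolding independent_mod_def
      by (elim allE[where x = "\<lambda>b. c (line_form a * b)"]) blast
    with M0 show "\<forall>b\<in>B. c b = 0" by (auto simp: B_def M_def)
  qed
  moreover have "\<exists>s\<in>mpoly3_vs.span B. f - s \<in> V" if f: "f \<in> forms t" for f
  (* If t + 1 > d, spanning follows by counting conditions instead of by a direct decomposition. *)
  proof (cases "Suc t \<le> d")
    case True
    obtain g where g: "g \<in> forms_below t"
      "f = homogenize a t (restrict_line a f) + line_form a * g"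
      using line_decomposition[OF f] by metis
    obtain s where s: "s \<in> mpoly3_vs.span B'" "g - s \<in> V'" using B'(4)[OF g(1)] by blast
    have "homogenize a t (restrict_line a f) \<in> mpoly3_vs.span B"
      unfolding homogenize_def using True
      by (intro mpoly3_vs.span_sum mpoly3_vs.span_scale mpoly3_vs.span_base)
        (auto simp: B_def M_def m_def)
    moreover have "line_form a * s \<in> mpoly3_vs.span B"
      using s(1) by (rule span_mult) (auto simp: B_def intro: mpoly3_vs.span_base)
    ultimately have "homogenize a t (restrict_line a f) + line_form a * s \<in> mpoly3_vs.span B"
      by (rule mpoly3_vs.span_add)
    moreover have "f - (homogenize a t (restrict_line a f) + line_form a * s) = line_form a * (g - s)"
      by (subst g(2)) (simp add: right_diff_distrib)
    ultimately show ?thesis using s(2) V_iff by metis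
  next
    case False
    have "sum_list (d # ds) = (\<Sum>b\<in>insert a X. line_degree T (insert a X) b)"
    proof -
      have "sum_list (map (line_degree T (insert a X)) L) = (\<Sum>b\<in>X. line_degree T (insert a X) b)"
        unfolding X_def using admissible_distinct[OF adm] by (rule sum_list_distinct_conv_sum_set)
      then show ?thesis using a degs by (simp add: d_def)
    qed
    moreover have "truncated_sum (d # ds) (Suc t) = sum_list (d # ds)"
      using sorted False by (intro truncated_sum_eq_sum_list) auto
    ultimately have card': "card B = (\<Sum>b\<in>insert a X. line_degree T (insert a X) b)"
      using card by simp
    have fin: "finite (T b)" if "b \<in> insert a X" for b
      using that a(1) admissible_finite[OF adm] unfolding X_def by auto
    obtain \<Phi> where \<Phi>: "finite \<Phi>" "card \<Phi> \<le> (\<Sum>b\<in>insert a X. line_degree T (insert a X) b)"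
      "\<And>\<phi>. \<phi> \<in> \<Phi> \<Longrightarrow> linear_functional \<phi>" "common_kernel \<Phi> = V"
      unfolding V_def by (rule prescribed_zeros_kernel[of "insert a X" T]) (use a fin in auto)
    show ?thesis
      using independent_mod_kernel_spans[OF \<Phi>(1) finB \<Phi>(3)] ind \<Phi>(2,4) card' by simp
  qed
  ultimately have "residue_basis V t B" using finB by (intro residue_basisI) auto
  with card show ?case
    using degs by (auto simp: V_def X_def d_def)
qed

section \<open>Ideals of reduced and double points\<close>

definition proj_point :: "'k::field \<Rightarrow> 'k \<Rightarrow> ('k ^ 3) set" where
  "proj_point a s = vec.span {plane_point a s}"

lemma proj_point_commute: "proj_point a s = proj_point s a"
  by (simp add: proj_point_def plane_point_commute)

lemma plane_point_neq_0: "plane_point a s \<noteq> 0"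
proof
  assume "plane_point a s = 0"
  then have "plane_point a s $ 3 = 0" by simp
  then show False by (simp add: plane_point_def)
qed

lemma proj_point_in_proj_plane: "proj_point a s \<in> proj_plane"
proof -
  have "vec.independent {plane_point a s}"
    using plane_point_neq_0[of a s] by simp
  then have "vec.dim (vec.span {plane_point a s}) = card {plane_point a s}"
    by (rule vec.dim_span_eq_card_independent)
  then show ?thesis by (simp add: proj_plane_def proj_point_def vec.subspace_span)
qed

text \<open>
  The coordinates of the point are the elementary symmetric functions of the two parameters.
\<close>

lemma proj_point_eqD:
  assumes "proj_point a s = proj_point a' s'"
  shows "(a = a' \<and> s = s') \<or> (a = s' \<and> s = a')"
proof -
  have "plane_point a s \<in> vec.span {plane_point a' s'}"
    using assms vec.span_base[of "plane_point a s" "{plane_point a s}"] by (simp add: proj_point_def)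
  then obtain k where k: "plane_point a s = k *s plane_point a' s'"
    by (auto simp: vec.span_singleton)
  then have c: "plane_point a s $ i = k * plane_point a' s' $ i" for i by simp
  from c[of 1] c[of 2] c[of 3] have sum: "a + s = a' + s'" and prod: "a * s = a' * s'"
    by (simp_all add: plane_point_def)
  have "(a - a') * (a - s') = a * a - a * (a' + s') + a' * s'" by (simp add: algebra_simps)
  also have "\<dots> = 0" unfolding sum[symmetric] prod[symmetric] by (simp add: algebra_simps)
  finally show ?thesis using sum by auto
qed

lemma eval3_scale:
  assumes "f \<in> forms i" shows "eval3 f (k *s v) = k ^ i * eval3 f v"
  unfolding eval3_def sum_distrib_left
proof (rule sum.cong[OF refl])
  fix m assume "m \<in> Poly_Mapping.keys f"
  then have m: "(\<Sum>j\<in>UNIV. Poly_Mapping.lookup m j) = i"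
    using assms by (auto simp: forms_def mon_degree_def)
  show "Poly_Mapping.lookup f m * (\<Prod>j\<in>UNIV. (k *s v) $ j ^ Poly_Mapping.lookup m j) =
      k ^ i * (Poly_Mapping.lookup f m * (\<Prod>j\<in>UNIV. v $ j ^ Poly_Mapping.lookup m j))"
    by (simp add: power_mult_distrib prod.distrib m[symmetric] power_sum)
qed

lemma subspace_restrict_dvd: "ideal.subspace {f. q dvd restrict_line a f}"
  by (auto simp: ideal.subspace_def)

lemma point_ideal_restrict:
  assumes "f \<in> point_ideal (proj_point a s)"
  shows "[:- s, 1:] dvd restrict_line a f"
proof -
  have "plane_point a s \<in> proj_point a s"
    by (simp add: proj_point_def vec.span_base)
  then have "point_ideal (proj_point a s) \<subseteq> {f. [:- s, 1:] dvd restrict_line a f}"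
    unfolding point_ideal_def
    by (intro ideal.span_minimal subspace_restrict_dvd)
      (auto simp: poly_eq_0_iff_dvd[symmetric] poly_restrict_line)
  with assms show ?thesis by blast
qed

text \<open>
  A form that vanishes at one representative of a point vanishes at all of them.
\<close>

lemma form_in_point_ideal_iff:
  assumes "f \<in> forms t"
  shows "f \<in> point_ideal (proj_point a s) \<longleftrightarrow> poly (restrict_line a f) s = 0"
proof
  assume "poly (restrict_line a f) s = 0"
  then have "\<forall>v\<in>proj_point a s. eval3 f v = 0"
    by (auto simp: proj_point_def vec.span_singleton eval3_scale[OF assms] poly_restrict_line)
  then show "f \<in> point_ideal (proj_point a s)"
    unfolding point_ideal_def using assms by (intro ideal.span_base) blast
qed (use point_ideal_restrict in \<open>auto simp: poly_eq_0_iff_dvd\<close>)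

lemma ideal_power_1:
  assumes "ideal.subspace I" shows "ideal_power I (Suc 0) = I"
proof -
  have "{a * b | a b. a \<in> I \<and> b \<in> (UNIV :: 'a set)} = I"
  proof
    show "{a * b | a b. a \<in> I \<and> b \<in> UNIV} \<subseteq> I"
      using ideal.subspace_scale[OF assms] by (auto simp: mult.commute)
    show "I \<subseteq> {a * b | a b. a \<in> I \<and> b \<in> UNIV}"
      by (force intro: exI[of _ 1])
  qed
  then show ?thesis using ideal.span_eq_iff[of I] assms by simp
qed

lemma subspace_point_ideal: "ideal.subspace (point_ideal P)"
  by (simp add: point_ideal_def ideal.subspace_span)

lemma ideal_power_2:
  "ideal_power (point_ideal P) 2 =
     ideal.span {f * g | f g. f \<in> point_ideal P \<and> g \<in> point_ideal P}"
  by (simp add: numeral_2_eq_2 ideal_power_1[OF subspace_point_ideal] del: ideal_power.simps(2)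
      add: ideal_power.simps(2)[of _ "Suc 0"])

lemma point_ideal_square_restrict:
  assumes "f \<in> ideal_power (point_ideal (proj_point a s)) 2"
  shows "double_root (restrict_line a f) s"
proof -
  have "ideal_power (point_ideal (proj_point a s)) 2 \<subseteq> {f. [:- s, 1:] ^ 2 dvd restrict_line a f}"
    unfolding ideal_power_2 power2_eq_square
    by (intro ideal.span_minimal subspace_restrict_dvd)
      (auto intro!: mult_dvd_mono point_ideal_restrict simp del: mult_pCons_left mult_pCons_right)
  with assms show ?thesis by (auto simp: double_root_iff_dvd)
qed

lemma homogenize_linear_mult:
  assumes "degree r \<le> t"
  shows "homogenize a (Suc t) ([:- b, 1:] * r) =
    (line_coord a - const3 b * var3 3) * homogenize a t r"
proof -
  have "[:- b, 1:] * r = smult (- b) r + pCons 0 r" by simp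
  then show ?thesis
    using assms
    by (simp only: homogenize_add homogenize_smult homogenize_pCons homogenize_Suc)
      (simp add: algebra_simps mpoly3_vs.scale_minus_left)
qed

text \<open>
  Membership in the square of the ideal amounts to vanishing of the value and of the derivatives along
  the two lines through the point. For sufficiency, split \<open>f\<close> along \<open>\<ell>\<^sub>a\<close>. The part recovered from the
  restriction, which is divisible by \<open>(X - b)\<^sup>2\<close>, is divisible by the square of a linear form through
  the point. The rest is the equation of \<open>\<ell>\<^sub>a\<close> times some \<open>g\<close>, and the double zero along \<open>\<ell>\<^sub>b\<close> forces
  \<open>g\<close> to vanish at the point as well.
\<close>

lemma form_in_point_ideal_square_iff:
  assumes f: "f \<in> forms t" and ab: "a \<noteq> b"
  shows "f \<in> ideal_power (point_ideal (proj_point a b)) 2 \<longleftrightarrow>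
    double_root (restrict_line a f) b \<and> double_root (restrict_line b f) a"
    (is "f \<in> ?J \<longleftrightarrow> ?R")
proof
  assume "f \<in> ?J"
  then show ?R using point_ideal_square_restrict[of f a b] point_ideal_square_restrict[of f b a]
    by (simp add: proj_point_commute)
next
  assume R: ?R
  define I where "I = point_ideal (proj_point a b)"
  have J: "x * y \<in> ?J" if "x \<in> I" "y \<in> I" for x y
    unfolding ideal_power_2 using that by (intro ideal.span_base) (auto simp: I_def)
  have subJ: "ideal.subspace ?J" by (simp add: ideal_power_2 ideal.subspace_span)
  obtain g where g: "g \<in> forms_below t"
    "f = homogenize a t (restrict_line a f) + line_form a * g"
    using line_decomposition[OF f] by metis
  have "homogenize a t (restrict_line a f) \<in> ?J"
  proof (cases "restrict_line a f = 0")
    case True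
    then show ?thesis using ideal.subspace_0[OF subJ] by simp
  next
    case False
    define u where "u = line_coord a - const3 b * var3 3"
    have "u \<in> forms 1"
      unfolding u_def
      by (intro mpoly3_vs.subspace_diff[OF subspace_forms] line_coord_forms forms_scale forms_var3)
    moreover have "restrict_line a u = [:- b, 1:]"
      by (simp add: u_def line_coord_def)
    ultimately have u: "u \<in> I" by (simp add: I_def form_in_point_ideal_iff)
    from R obtain r where r: "restrict_line a f = [:- b, 1:] * ([:- b, 1:] * r)"
      unfolding double_root_iff_dvd power2_eq_square dvd_def mult.assoc by blast
    with False have "r \<noteq> 0" by auto
    then have "degree (restrict_line a f) = Suc (Suc (degree r))"
      unfolding r by (subst degree_mult_eq; simp del: mult_pCons_left)+
    with degree_restrict_line_le[OF f, of a] obtain n where n: "t = Suc (Suc n)" "degree r \<le> n"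
      by (cases t; cases "t - 1") auto
    have "degree ([:- b, 1:] * r) \<le> Suc n"
      using n \<open>r \<noteq> 0\<close> by (subst degree_mult_eq) (auto simp del: mult_pCons_left)
    then have "homogenize a t (restrict_line a f) = homogenize a n r * (u * u)"
      unfolding r n u_def using n
      by (simp only: homogenize_linear_mult) (simp only: mult_ac)
    then show ?thesis using ideal.subspace_scale[OF subJ J[OF u u]] by simp
  qed
  moreover have "line_form a * g \<in> ?J"
  proof -
    have line: "line_form a \<in> I"
      by (simp add: I_def form_in_point_ideal_iff[OF line_form_forms] restrict_line_line_form)
    have "restrict_line b (homogenize a t (restrict_line a f) + line_form a * g) = restrict_line b f"
      using g(2) by simp
    moreover have "double_root (restrict_line b (homogenize a t (restrict_line a f))) a"
      using point_ideal_square_restrict[of _ b a] \<open>homogenize a t (restrict_line a f) \<in> ?J\<close>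
      by (simp add: proj_point_commute)
    moreover have "double_root (p + q) a \<Longrightarrow> double_root p a \<Longrightarrow> double_root q a" for p q
      by (simp add: double_root_def pderiv_add)
    ultimately have "double_root (restrict_line b (line_form a * g)) a"
      using R by (metis restrict_line_add)
    then have "poly (restrict_line b g) a = 0"
      using double_root_linear_mult_same[of "b - a" _ a "restrict_line b g"] ab
      by (simp only: restrict_line_mult restrict_line_line_form) simp
    then have "g \<in> I"
      using g(1) form_in_point_ideal_iff[of g _ b a] ideal.subspace_0[OF subspace_point_ideal]
      by (cases t) (auto simp: forms_below_def I_def proj_point_commute)
    with line show ?thesis by (rule J)
  qed
  ultimately show "f \<in> ?J" using ideal.subspace_add[OF subJ] g(2) by metis
qed

section \<open>The scheme of a star configuration\<close>

text \<open>
  The second summand raises the multiplicity of the double points from 1 to 2, since they occur in the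
  first summand too.
\<close>

definition star_scheme :: "('k::field \<Rightarrow> 'k set) \<Rightarrow> 'k set \<Rightarrow> ('k ^ 3) set multiset" where
  "star_scheme T X =
     mset_set {proj_point a s | a s. a \<in> X \<and> s \<in> T a} +
     mset_set {proj_point a b | a b. a \<in> X \<and> b \<in> X \<and> a \<in> T b}"

lemma residue_basis_cong:
  fixes I J :: "'k::field mpoly3 set"
  assumes IJ: "I \<inter> forms t = J \<inter> forms t" and B: "residue_basis I t B"
  shows "residue_basis J t B"
proof -
  have mem: "f \<in> I \<longleftrightarrow> f \<in> J" if "f \<in> forms t" for f using IJ that by blast
  have sum: "(\<Sum>b\<in>B. const3 (c b) * b) \<in> forms t" for c
    using B by (intro mpoly3_vs.subspace_sum[OF subspace_forms] forms_scale)
      (auto simp: residue_basis_def)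
  have diff: "f - (\<Sum>b\<in>B. const3 (c b) * b) \<in> forms t" if "f \<in> forms t" for f c
    using mpoly3_vs.subspace_diff[OF subspace_forms that sum] .
  show ?thesis using B unfolding residue_basis_def by (simp add: mem sum diff)
qed

locale star_configuration =
  fixes T :: "'k::field \<Rightarrow> 'k set" and L :: "'k list"
  assumes admissible: "admissible T L"
begin

abbreviation (input) "X \<equiv> set L"

definition "edges = {(a, b). a \<in> X \<and> b \<in> X \<and> a \<in> T b}"
definition "free_params = {(a, s). a \<in> X \<and> s \<in> T a - X}"

lemma finite_edges: "finite edges"
  by (rule finite_subset[of _ "X \<times> X"]) (auto simp: edges_def)

lemma finite_free_params: "finite free_params"
  by (rule finite_subset[of _ "Sigma X T"])
    (auto simp: free_params_def admissible_finite[OF admissible])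

lemma inj_edges: "inj_on (case_prod proj_point) edges"
proof (intro inj_onI, clarsimp)
  fix a b a' b' assume e: "(a, b) \<in> edges" "(a', b') \<in> edges" "proj_point a b = proj_point a' b'"
  then have "\<not> (a = b' \<and> b = a')"
    using admissible_asym[OF admissible, of a b] by (auto simp: edges_def)
  with proj_point_eqD[OF e(3)] show "a = a' \<and> b = b'" by blast
qed

lemma inj_free_params: "inj_on (case_prod proj_point) free_params"
proof (intro inj_onI, clarsimp)
  fix a s a' s'
  assume e: "(a, s) \<in> free_params" "(a', s') \<in> free_params" "proj_point a s = proj_point a' s'"
  then have "\<not> (a = s' \<and> s = a')" by (auto simp: free_params_def)
  with proj_point_eqD[OF e(3)] show "a = a' \<and> s = s'" by blast
qed

lemma edges_free_params_disjoint:
  "case_prod proj_point ` edges \<inter> case_prod proj_point ` free_params = {}"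
proof -
  have False if "(a, b) \<in> edges" "(a', s) \<in> free_params" "proj_point a b = proj_point a' s"
    for a b a' s
    using proj_point_eqD[OF that(3)] that(1,2) by (auto simp: edges_def free_params_def)
  then show ?thesis by force
qed

lemma star_scheme_altdef:
  "star_scheme T X = mset_set (case_prod proj_point ` free_params)
     + repeat_mset 2 (mset_set (case_prod proj_point ` edges))"
proof -
  have "{proj_point a b | a b. a \<in> X \<and> b \<in> X \<and> a \<in> T b} = case_prod proj_point ` edges"
    by (auto simp: edges_def)
  moreover have "{proj_point a s | a s. a \<in> X \<and> s \<in> T a}
      = case_prod proj_point ` edges \<union> case_prod proj_point ` free_params"
  proof (intro equalityI subsetI)
    fix P assume "P \<in> {proj_point a s | a s. a \<in> X \<and> s \<in> T a}"
    then obtain a s where "P = proj_point a s" "a \<in> X" "s \<in> T a" by blast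
    then show "P \<in> case_prod proj_point ` edges \<union> case_prod proj_point ` free_params"
      using image_eqI[of P "case_prod proj_point" "(s, a)" edges]
        image_eqI[of P "case_prod proj_point" "(a, s)" free_params]
      by (cases "s \<in> X") (simp_all add: edges_def free_params_def proj_point_commute[of a s])
  next
    fix P assume "P \<in> case_prod proj_point ` edges \<union> case_prod proj_point ` free_params"
    then show "P \<in> {proj_point a s | a s. a \<in> X \<and> s \<in> T a}"
      by (auto simp: edges_def free_params_def) (metis proj_point_commute)
  qed
  moreover have "repeat_mset 2 M = M + M" for M :: "('k ^ 3) set multiset"
    by (simp add: multiset_eq_iff)
  ultimately show ?thesis
    using finite_edges finite_free_params edges_free_params_disjoint
    by (simp add: star_scheme_def mset_set_Union)
qed

lemma count_star_scheme:
  "count (star_scheme T X) P =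
    (if P \<in> case_prod proj_point ` edges then 2
     else if P \<in> case_prod proj_point ` free_params then 1 else 0)"
  using finite_edges finite_free_params edges_free_params_disjoint
  by (auto simp: star_scheme_altdef count_mset_set')

lemma set_star_scheme:
  "set_mset (star_scheme T X) =
    case_prod proj_point ` edges \<union> case_prod proj_point ` free_params"
  by (auto simp: count_star_scheme simp flip: count_greater_zero_iff split: if_splits)

text \<open>
  Each double point is counted three times on the right: twice on the earlier of its lines, once on the
  later one.
\<close>

lemma card_free_params:
  "card free_params + 3 * card edges = (\<Sum>a\<in>X. line_degree T X a)"
proof -
  have fin: "finite (T a)" if "a \<in> X" for a using admissible_finite[OF admissible that] .
  have "free_params = Sigma X (\<lambda>a. T a - X)" by (auto simp: free_params_def)
  then have free: "card free_params = (\<Sum>a\<in>X. card (T a - X))" using fin by simp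
  have "edges = Sigma X (\<lambda>a. {b \<in> X. a \<in> T b})" by (auto simp: edges_def)
  then have out: "card edges = (\<Sum>a\<in>X. card {b \<in> X. a \<in> T b})" by simp
  \<comment> \<open>Seen from the later line, the double points are the elements of \<open>T a\<close> that are lines.\<close>
  have "prod.swap ` edges = Sigma X (\<lambda>a. T a \<inter> X)" by (auto simp: edges_def)
  then have "card edges = card (Sigma X (\<lambda>a. T a \<inter> X))"
    by (metis card_image inj_on_subset inj_swap subset_UNIV)
  also have "\<dots> = (\<Sum>a\<in>X. card (T a \<inter> X))" by simp
  finally have "card free_params + card edges = (\<Sum>a\<in>X. card (T a - X) + card (T a \<inter> X))"
    by (simp add: free sum.distrib)
  also have "\<dots> = (\<Sum>a\<in>X. card (T a))"
    by (intro sum.cong refl) (metis add.commute card_Int_Diff fin)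
  finally have "card free_params + card edges + 2 * card edges =
      (\<Sum>a\<in>X. card (T a)) + 2 * (\<Sum>a\<in>X. card {b \<in> X. a \<in> T b})"
    using out by simp
  then show ?thesis by (simp add: line_degree_def sum.distrib sum_distrib_left)
qed

lemma double_and_reduced_star_scheme:
  "double_and_reduced_points (star_scheme T X) (card edges) (int (card free_params))"
proof -
  have 2: "{P \<in> set_mset (star_scheme T X). count (star_scheme T X) P = 2} =
      case_prod proj_point ` edges"
    by (auto simp: set_star_scheme count_star_scheme)
  have 1: "{P \<in> set_mset (star_scheme T X). count (star_scheme T X) P = 1} =
      case_prod proj_point ` free_params"
    using edges_free_params_disjoint by (auto simp: set_star_scheme count_star_scheme)
  show ?thesis
    unfolding double_and_reduced_points_def 1 2 card_image[OF inj_edges] card_image[OF inj_free_params]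
    by (auto simp: fat_points_def set_star_scheme count_star_scheme proj_point_in_proj_plane)
qed

lemma fat_ideal_star_scheme:
  "fat_ideal (star_scheme T X) \<inter> forms t = prescribed_zeros T X \<inter> forms t"
proof (rule set_eqI)
  fix f
  have neq: "a \<noteq> b" if "(a, b) \<in> edges" for a b
    using admissible_asym[OF admissible] that by (auto simp: edges_def)
  have "f \<in> fat_ideal (star_scheme T X) \<longleftrightarrow> f \<in> prescribed_zeros T X" if f: "f \<in> forms t"
  proof -
    have split: "(\<forall>P\<in>A \<union> B. f \<in> ideal_power (point_ideal P) (if P \<in> A then 2 else if P \<in> B then 1 else 0))
        \<longleftrightarrow> (\<forall>P\<in>A. f \<in> ideal_power (point_ideal P) 2) \<and> (\<forall>P\<in>B. f \<in> ideal_power (point_ideal P) 1)"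
      if "A \<inter> B = {}" for A B :: "('k ^ 3) set set"
      using that by (auto simp del: ideal_power.simps One_nat_def)
    have "f \<in> fat_ideal (star_scheme T X) \<longleftrightarrow>
        (\<forall>(a, b)\<in>edges. f \<in> ideal_power (point_ideal (proj_point a b)) 2) \<and>
        (\<forall>(a, s)\<in>free_params. f \<in> ideal_power (point_ideal (proj_point a s)) 1)"
      unfolding fat_ideal_def set_star_scheme count_star_scheme INT_iff
        split[OF edges_free_params_disjoint]
      by (simp add: case_prod_unfold del: ideal_power.simps One_nat_def)
    also have "\<dots> \<longleftrightarrow>
        (\<forall>(a, b)\<in>edges. double_root (restrict_line a f) b \<and> double_root (restrict_line b f) a) \<and>
        (\<forall>(a, s)\<in>free_params. poly (restrict_line a f) s = 0)"
      using form_in_point_ideal_square_iff[OF f neq] form_in_point_ideal_iff[OF f]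
      by (simp add: case_prod_unfold Ball_def ideal_power_1[OF subspace_point_ideal]
          del: ideal_power.simps)
    also have "\<dots> \<longleftrightarrow> f \<in> prescribed_zeros T X"
      unfolding prescribed_zeros_def edges_def free_params_def by auto
    finally show ?thesis .
  qed
  then show "f \<in> fat_ideal (star_scheme T X) \<inter> forms t \<longleftrightarrow> f \<in> prescribed_zeros T X \<inter> forms t"
    by auto
qed

theorem hilbert_function_star_scheme:
  assumes "sorted_wrt (>) (map (line_degree T X) L)"
    and "\<And>a. a \<in> X \<Longrightarrow> 0 < line_degree T X a"
  shows "hilbert_function (fat_ideal (star_scheme T X)) t =
    truncated_sum (map (line_degree T X) L) (Suc t)"
proof -
  obtain B where B: "residue_basis (prescribed_zeros T X) t B"
    "card B = truncated_sum (map (line_degree T X) L) (Suc t)"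
    using residue_basis_prescribed_zeros[OF admissible assms] by blast
  have "residue_basis (fat_ideal (star_scheme T X)) t B"
    by (rule residue_basis_cong[OF _ B(1)]) (simp add: fat_ideal_star_scheme)
  then show ?thesis using hilbert_function_eq_card[OF subspace_fat_ideal] B(2) by metis
qed

end

section \<open>Conjugates of valid Hilbert functions\<close>

lemma valid_antimono:
  assumes v: "valid_hilbert_function h \<sigma> \<alpha>" and "\<alpha> \<le> k" "k \<le> j" "j \<le> \<sigma>"
  shows "h ! j \<le> h ! k"
  using assms(3,4)
proof (induction j rule: dec_induct)
  case (step j)
  then have "h ! Suc j \<le> h ! j"
    using v assms(2) by (simp add: valid_hilbert_function_def)
  with step show ?case by simp
qed simp

lemma valid_nth_le:
  assumes v: "valid_hilbert_function h \<sigma> \<alpha>" and j: "j < length h"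
  shows "h ! j \<le> \<alpha>"
proof (cases "j < \<alpha>")
  case False
  then have "h ! j \<le> h ! \<alpha>" using valid_antimono[OF v, of \<alpha> j] v j
    by (simp add: valid_hilbert_function_def)
  also have "\<dots> \<le> \<alpha>" using v j False by (simp add: valid_hilbert_function_def)
  finally show ?thesis .
qed (use v in \<open>simp add: valid_hilbert_function_def\<close>)

text \<open>
  The sequence \<open>h\<close> rises to \<open>\<alpha>\<close> in steps of 1 and does not increase afterwards, so it is at least \<open>i\<close>
  on an interval, which starts at \<open>i - 1\<close>.
\<close>

lemma conjugate_interval:
  assumes v: "valid_hilbert_function h \<sigma> \<alpha>" and i: "1 \<le> i" "i \<le> \<alpha>"
  shows "{j. j < length h \<and> i \<le> h ! j} = {i - 1..<i - 1 + conjugate h i}"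
proof -
  define S where "S = {j. j < length h \<and> i \<le> h ! j}"
  have rise: "h ! j = j + 1" if "j < \<alpha>" for j
    using v that by (simp add: valid_hilbert_function_def)
  have len: "length h = \<sigma> + 1" "\<alpha> \<le> \<sigma> + 1" using v by (auto simp: valid_hilbert_function_def)
  have fin: "finite S" by (simp add: S_def)
  have first: "i - 1 \<in> S" using i rise[of "i - 1"] len by (simp add: S_def)
  have lower: "i - 1 \<le> j" if "j \<in> S" for j
  proof (rule ccontr)
    assume "\<not> i - 1 \<le> j"
    then have "j < \<alpha>" "j + 1 < i" using i by auto
    then show False using that rise[of j] by (simp add: S_def)
  qed
  have convex: "k \<in> S" if "i - 1 \<le> k" "k \<le> j" "j \<in> S" for j k
  proof (cases "k < \<alpha>")
    case True
    then show ?thesis using that i rise[of k] by (simp add: S_def)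
  next
    case False
    then have "h ! j \<le> h ! k" using valid_antimono[OF v, of k j] that len by (simp add: S_def)
    then show ?thesis using that by (simp add: S_def)
  qed
  have Max: "Max S \<in> S" "\<And>j. j \<in> S \<Longrightarrow> j \<le> Max S" using fin first by (auto intro: Max_in)
  have "S = {i - 1..Max S}"
  proof (intro equalityI subsetI)
    show "j \<in> {i - 1..Max S}" if "j \<in> S" for j using lower Max(2) that by simp
    show "j \<in> S" if "j \<in> {i - 1..Max S}" for j using convex[OF _ _ Max(1), of j] that by simp
  qed
  moreover have "i - 1 \<le> Max S" using Max(2)[OF first] .
  ultimately have "S = {i - 1..<i - 1 + card S}"
    by (metis atLeastLessThanSuc_atLeastAtMost card_atLeastAtMost le_Suc_eq le_add_diff_inverse)
  then show ?thesis by (simp add: conjugate_def S_def)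
qed

lemma conjugate_pos:
  assumes v: "valid_hilbert_function h \<sigma> \<alpha>" and i: "1 \<le> i" "i \<le> \<alpha>"
  shows "0 < conjugate h i"
proof -
  have "i - 1 \<in> {j. j < length h \<and> i \<le> h ! j}"
    using v i by (auto simp: valid_hilbert_function_def)
  then show ?thesis unfolding conjugate_interval[OF assms] by simp
qed

lemma conjugate_strict_antimono:
  assumes v: "valid_hilbert_function h \<sigma> \<alpha>" and i: "1 \<le> i" "i < k" "k \<le> \<alpha>"
  shows "conjugate h k < conjugate h i"
  unfolding conjugate_def
proof (rule psubset_card_mono)
  have "i - 1 \<in> {j. j < length h \<and> i \<le> h ! j}" "i - 1 \<notin> {j. j < length h \<and> k \<le> h ! j}"
    using v i by (auto simp: valid_hilbert_function_def)
  then show "{j. j < length h \<and> k \<le> h ! j} \<subset> {j. j < length h \<and> i \<le> h ! j}"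
    using i by auto
qed simp

lemma conjugate_1:
  assumes "valid_hilbert_function h \<sigma> \<alpha>" shows "conjugate h 1 = \<sigma> + 1"
proof -
  have "{j. j < length h \<and> 1 \<le> h ! j} = {..<\<sigma> + 1}"
    using assms by (auto simp: valid_hilbert_function_def Suc_le_eq)
  then show ?thesis by (simp add: conjugate_def)
qed

lemma sum_nth_eq_sum_card:
  assumes v: "valid_hilbert_function h \<sigma> \<alpha>" and A: "finite A" "A \<subseteq> {..<length h}"
  shows "(\<Sum>j\<in>A. h ! j) = (\<Sum>i=1..\<alpha>. card {j \<in> A. i \<le> h ! j})"
proof -
  have "h ! j = (\<Sum>i=1..\<alpha>. if i \<le> h ! j then 1 else 0)" if "j \<in> A" for j
  proof -
    have "h ! j \<le> \<alpha>" using valid_nth_le[OF v] A that by auto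
    then have "{1..\<alpha>} \<inter> {i. i \<le> h ! j} = {1..h ! j}" by auto
    then show ?thesis by (simp add: sum.If_cases)
  qed
  then have "(\<Sum>j\<in>A. h ! j) = (\<Sum>j\<in>A. \<Sum>i=1..\<alpha>. if i \<le> h ! j then 1 else 0)"
    by (intro sum.cong refl) auto
  also have "\<dots> = (\<Sum>i=1..\<alpha>. \<Sum>j\<in>A. if i \<le> h ! j then 1 else 0)" by (rule sum.swap)
  also have "\<dots> = (\<Sum>i=1..\<alpha>. card {j \<in> A. i \<le> h ! j})"
    using A by (simp add: sum.If_cases Int_def)
  finally show ?thesis .
qed

lemma sum_list_eq_sum_conjugate:
  assumes "valid_hilbert_function h \<sigma> \<alpha>"
  shows "sum_list h = (\<Sum>i=1..\<alpha>. conjugate h i)"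
  using sum_nth_eq_sum_card[OF assms, of "{..<length h}"]
  by (simp add: sum_list_sum_nth atLeast0LessThan conjugate_def)

lemma cumulative_eq_truncated_sum:
  assumes v: "valid_hilbert_function h \<sigma> \<alpha>"
  shows "cumulative h t = truncated_sum (map (conjugate h) [1..<Suc \<alpha>]) (Suc t)"
proof -
  define A where "A = {..t} \<inter> {..<length h}"
  have "cumulative h t = (\<Sum>j\<in>A. h ! j)"
    by (simp add: cumulative_def A_def sum.If_cases lessThan_def)
  also have "\<dots> = (\<Sum>i=1..\<alpha>. card {j \<in> A. i \<le> h ! j})"
    by (rule sum_nth_eq_sum_card[OF v]) (auto simp: A_def)
  also have "\<dots> = (\<Sum>i=1..\<alpha>. min (conjugate h i) (Suc t - (i - 1)))"
  proof (rule sum.cong[OF refl])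
    fix i assume i: "i \<in> {1..\<alpha>}"
    have "{j \<in> A. i \<le> h ! j} = {..t} \<inter> {j. j < length h \<and> i \<le> h ! j}" by (auto simp: A_def)
    also have "\<dots> = {..t} \<inter> {i - 1..<i - 1 + conjugate h i}"
      using conjugate_interval[OF v, of i] i by simp
    also have "\<dots> = {i - 1..<min (Suc t) (i - 1 + conjugate h i)}" by auto
    finally show "card {j \<in> A. i \<le> h ! j} = min (conjugate h i) (Suc t - (i - 1))" by auto
  qed
  also have "\<dots> = (\<Sum>i<\<alpha>. min (conjugate h (Suc i)) (Suc t - i))"
    by (rule sum.reindex_bij_witness[of _ Suc "\<lambda>i. i - 1"]) auto
  also have "\<dots> = truncated_sum (map (conjugate h) [1..<Suc \<alpha>]) (Suc t)"
    unfolding truncated_sum_nth by (rule sum.cong) (auto simp del: upt_Suc)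
  finally show ?thesis .
qed

lemma d_bound_le_choose: "d_bound h \<alpha> \<le> \<alpha> choose 2"
proof -
  have "d_bound h \<alpha> \<le> (\<Sum>i = 1..\<alpha> - 1. \<alpha> - i)"
    unfolding d_bound_def
  proof (rule sum_mono)
    fix i
    have "card {k. i + 1 \<le> k \<and> k \<le> \<alpha> \<and> i \<le> conjugate h k} \<le> card {i + 1..\<alpha>}"
      by (rule card_mono) auto
    then show "min ((conjugate h i - (i - 1)) div 2)
        (card {k. i + 1 \<le> k \<and> k \<le> \<alpha> \<and> i \<le> conjugate h k}) \<le> \<alpha> - i" by simp
  qed
  also have "\<dots> = (\<Sum>i = 1..\<alpha> - 1. i)"
    by (rule sum.reindex_bij_witness[of _ "\<lambda>i. \<alpha> - i" "\<lambda>i. \<alpha> - i"]) auto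
  also have "\<dots> = \<alpha> choose 2"
  proof (cases \<alpha>)
    case (Suc n)
    have "(\<Sum>i = 1..n. i) = Suc n choose 2"
      by (induction n) (simp_all add: numeral_2_eq_2)
    with Suc show ?thesis by simp
  qed simp
  finally show ?thesis .
qed

text \<open>
  The first summand of \<open>d\<close> alone is the lower bound, because \<open>h\<^sub>1\<^sup>\<star> = \<sigma> + 1\<close> and all \<open>h\<^sub>k\<^sup>\<star>\<close> are positive.
\<close>

lemma d_bound_ge:
  assumes v: "valid_hilbert_function h \<sigma> \<alpha>"
  shows "min ((\<sigma> + 1) div 2) (\<alpha> - 1) \<le> d_bound h \<alpha>"
proof (cases "\<alpha> \<le> 1")
  case False
  have "{k. 1 + 1 \<le> k \<and> k \<le> \<alpha> \<and> 1 \<le> conjugate h k} = {2..\<alpha>}"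
    using conjugate_pos[OF v] by (auto simp: Suc_le_eq)
  then have "min ((\<sigma> + 1) div 2) (\<alpha> - 1) = min ((conjugate h 1 - (1 - 1)) div 2)
      (card {k. 1 + 1 \<le> k \<and> k \<le> \<alpha> \<and> 1 \<le> conjugate h k})"
    using conjugate_1[OF v] by simp
  also have "\<dots> \<le> d_bound h \<alpha>"
    unfolding d_bound_def by (rule member_le_sum) (use False in auto)
  finally show ?thesis .
qed simp

section \<open>Choosing the pairs of lines that carry double points\<close>

text \<open>
  Line \<open>k\<close> is joined to at most \<open>min (k - 1) h\<^sub>k\<^sup>\<star>\<close> earlier lines, since only lines \<open>i \<le> h\<^sub>k\<^sup>\<star>\<close> are
  joined to it. If \<open>h\<^sub>k\<^sup>\<star> \<ge> k - 1\<close>, what is left of \<open>h\<^sub>k\<^sup>\<star>\<close> suffices for its joins to later lines, each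
  of which costs 2; otherwise it has no such joins.
\<close>

lemma exists_pairs_of_lines:
  assumes e: "e \<le> d_bound h \<alpha>"
  obtains G where "finite G" "card G = e" "\<And>i k. (i, k) \<in> G \<Longrightarrow> 1 \<le> i \<and> i < k \<and> k \<le> \<alpha>"
    "\<And>k. card {i. (i, k) \<in> G} + 2 * card {j. (k, j) \<in> G} \<le> conjugate h k"
proof -
  define K where "K i = {k. i + 1 \<le> k \<and> k \<le> \<alpha> \<and> i \<le> conjugate h k}" for i
  define m where "m i = min ((conjugate h i - (i - 1)) div 2) (card (K i))" for i
  have finK: "finite (K i)" for i by (rule finite_subset[of _ "{..\<alpha>}"]) (auto simp: K_def)
  have "\<exists>A\<subseteq>K i. card A = m i" for i
    using obtain_subset_with_card_n[of "m i" "K i"] by (metis m_def min.cobounded2)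
  then obtain A where A: "\<And>i. A i \<subseteq> K i" "\<And>i. card (A i) = m i" by metis
  have finA: "finite (A i)" for i using A(1) finK finite_subset by blast
  have "card (Sigma {1..\<alpha> - 1} A) = d_bound h \<alpha>"
    by (simp add: card_SigmaI finA A(2) d_bound_def m_def K_def)
  then obtain G where G: "G \<subseteq> Sigma {1..\<alpha> - 1} A" "card G = e" "finite G"
    using obtain_subset_with_card_n[of e "Sigma {1..\<alpha> - 1} A"] e by metis
  have GD: "1 \<le> i \<and> i < k \<and> k \<le> \<alpha> \<and> i \<le> conjugate h k \<and> k \<in> A i" if "(i, k) \<in> G" for i k
    using G(1) A(1)[of i] that by (auto simp: K_def)
  have "card {i. (i, k) \<in> G} + 2 * card {j. (k, j) \<in> G} \<le> conjugate h k" for k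
  proof -
    have "card {i. (i, k) \<in> G} \<le> card {1..min (k - 1) (conjugate h k)}"
      by (rule card_mono) (use GD in fastforce)+
    moreover have "card {j. (k, j) \<in> G} \<le> card (A k)"
      by (rule card_mono) (use GD finA in auto)
    ultimately have "card {i. (i, k) \<in> G} \<le> k - 1" "card {i. (i, k) \<in> G} \<le> conjugate h k"
      "card {j. (k, j) \<in> G} \<le> (conjugate h k - (k - 1)) div 2"
      by (simp_all add: A(2) m_def)
    then show ?thesis by linarith
  qed
  with G GD show thesis by (intro that[of G]) blast+
qed

section \<open>The star configuration of a pair selection\<close>

text \<open>
  The lines are those of the integers \<open>1, \<dots>, \<alpha>\<close>, and line \<open>k\<close> is filled up to degree \<open>h\<^sub>k\<^sup>\<star>\<close> with
  reduced points whose parameters are integers above \<open>\<alpha>\<close>, hence not on any other line.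
\<close>

lemma exists_double_and_reduced_points:
  fixes h :: "nat list"
  assumes v: "valid_hilbert_function h \<sigma> \<alpha>" and e: "e \<le> d_bound h \<alpha>"
  shows "\<exists>Z :: ('k::field_char_0 ^ 3) set multiset.
    double_and_reduced_points Z e (int (sum_list h) - 3 * int e) \<and>
    hilbert_function (fat_ideal Z) = cumulative h"
proof -
  obtain G where G: "finite G" "card G = e" "\<And>i k. (i, k) \<in> G \<Longrightarrow> 1 \<le> i \<and> i < k \<and> k \<le> \<alpha>"
    "\<And>k. card {i. (i, k) \<in> G} + 2 * card {j. (k, j) \<in> G} \<le> conjugate h k"
    using exists_pairs_of_lines[OF e] by metis
  define r where
    "r k = conjugate h k - (card {i. (i, k) \<in> G} + 2 * card {j. (k, j) \<in> G})" for k
  define N where "N k = {i. (i, k) \<in> G} \<union> {Suc \<alpha>..<Suc \<alpha> + r k}" for k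
  define T :: "'k \<Rightarrow> 'k set" where "T x = (\<Union>k\<in>{k. of_nat k = x}. of_nat ` N k)" for x
  define L :: "'k list" where "L = map of_nat [1..<Suc \<alpha>]"
  have set_L: "set L = of_nat ` {1..\<alpha>}" by (auto simp: L_def)
  have T: "T (of_nat k) = of_nat ` N k" for k by (auto simp: T_def)
  have mem_T: "of_nat i \<in> T (of_nat k) \<longleftrightarrow> i \<in> N k" for i k
    by (auto simp: T)
  have fin_in: "finite {i. (i, k) \<in> G}" for k
    by (rule finite_subset[of _ "{..\<alpha>}"]) (use G(3) in fastforce)+
  \<comment> \<open>By induction on the suffixes of the list of lines.\<close>
  have "admissible T (map of_nat [m..<Suc \<alpha>])" if "1 \<le> m" "m \<le> Suc \<alpha>" for m
    using that(2,1)
  proof (induction m rule: inc_induct)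
    case (step m)
    then have "[m..<Suc \<alpha>] = m # [Suc m..<Suc \<alpha>]" by (simp add: upt_conv_Cons del: upt_Suc)
    moreover have "N m \<inter> {m..<Suc \<alpha>} = {}" using G(3) by (fastforce simp: N_def)
    then have "T (of_nat m) \<inter> of_nat ` {m..<Suc \<alpha>} = {}" unfolding T by (auto dest!: of_nat_eq_iff[THEN iffD1])
    moreover have "{m..<Suc \<alpha>} = insert m {Suc m..<Suc \<alpha>}" using step by auto
    moreover have "finite (T (of_nat m))" using fin_in by (simp add: T N_def)
    ultimately show ?case using step by (auto simp del: upt_Suc)
  qed simp
  from this[of 1] have adm: "admissible T L" by (simp add: L_def del: upt_Suc)
  interpret star_configuration T L using adm by unfold_locales
  have deg: "line_degree T (set L) (of_nat k) = conjugate h k" if k: "k \<in> {1..\<alpha>}" for k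
  proof -
    have "{i. (i, k) \<in> G} \<inter> {Suc \<alpha>..<Suc \<alpha> + r k} = {}" using G(3) by fastforce
    then have "card (N k) = card {i. (i, k) \<in> G} + r k"
      unfolding N_def using fin_in by (simp add: card_Un_disjoint)
    then have "card (T (of_nat k)) = card {i. (i, k) \<in> G} + r k"
      by (simp add: T card_image inj_on_def)
    moreover have "{b \<in> set L. of_nat k \<in> T b} = of_nat ` {j. (k, j) \<in> G}"
      using G(3) k by (fastforce simp: set_L mem_T N_def)
    then have "card {b \<in> set L. of_nat k \<in> T b} = card {j. (k, j) \<in> G}"
      by (simp add: card_image inj_on_def)
    ultimately show ?thesis using G(4)[of k] by (simp add: line_degree_def r_def)
  qed
  have degs: "map (line_degree T (set L)) L = map (conjugate h) [1..<Suc \<alpha>]"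
    using deg by (simp add: L_def del: upt_Suc)
  have "sorted_wrt (>) (map (conjugate h) [1..<Suc \<alpha>])"
    using conjugate_strict_antimono[OF v]
    by (auto simp: sorted_wrt_iff_nth_less simp del: upt_Suc)
  then have "sorted_wrt (>) (map (line_degree T (set L)) L)" unfolding degs .
  moreover have "0 < line_degree T (set L) a" if "a \<in> set L" for a
    using that deg conjugate_pos[OF v] by (auto simp: set_L)
  ultimately have "hilbert_function (fat_ideal (star_scheme T (set L))) t = cumulative h t" for t
    using hilbert_function_star_scheme degs cumulative_eq_truncated_sum[OF v] by metis
  moreover have "edges = (\<lambda>(i, k). (of_nat i, of_nat k)) ` G"
    using G(3) by (fastforce simp: edges_def set_L mem_T N_def)
  then have "card edges = e"
    using G(2) by (simp add: card_image inj_on_def split_beta prod_eq_iff)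
  moreover have "(\<Sum>a\<in>set L. line_degree T (set L) a) = sum_list h"
  proof -
    have "(\<Sum>a\<in>set L. line_degree T (set L) a) = (\<Sum>k\<in>{1..\<alpha>}. line_degree T (set L) (of_nat k))"
      using sum.reindex[of "of_nat :: nat \<Rightarrow> 'k" "{1..\<alpha>}" "line_degree T (set L)"]
      unfolding set_L[symmetric] by (simp add: inj_on_def)
    also have "\<dots> = (\<Sum>k\<in>{1..\<alpha>}. conjugate h k)" using deg by (rule sum.cong[OF refl])
    finally show ?thesis by (simp add: sum_list_eq_sum_conjugate[OF v])
  qed
  then have "int (card free_params) = int (sum_list h) - 3 * int (card edges)"
    using card_free_params by simp
  ultimately show ?thesis using double_and_reduced_star_scheme by (intro exI[of _ "star_scheme T (set L)"]) auto
qed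

theorem corollary3p10:
  fixes h :: "nat list" and \<sigma> \<alpha> d :: nat
  assumes valid: "valid_hilbert_function h \<sigma> \<alpha>"
    and d: "d = d_bound h \<alpha>"
  shows "(min ((\<sigma> + 1) div 2) (\<alpha> - 1) \<le> d \<and> d \<le> \<alpha> choose 2) \<and>
         (\<forall>e. 1 \<le> e \<and> e \<le> d \<longrightarrow>
           (\<exists>Z :: ('k::{alg_closed_field, field_char_0} ^ 3) set multiset.
              double_and_reduced_points Z e (int (sum_list h) - 3 * int e) \<and>
              hilbert_function (fat_ideal Z) = cumulative h)) \<and>
         (\<forall>e. e = min ((\<sigma> + 1) div 2) (\<alpha> - 1) \<longrightarrow>
           (\<exists>Z :: ('k ^ 3) set multiset.
              double_and_reduced_points Z e (int (sum_list h) - 3 * int e) \<and>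
              hilbert_function (fat_ideal Z) = cumulative h))"
  using exists_double_and_reduced_points[OF valid, where 'k = 'k] d_bound_ge[OF valid] d_bound_le_choose[of h \<alpha>]
  unfolding d by blast

end
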